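(* For every integer $k\geq 1$ and every $c>0$ there exist $c_0>0$, $c_1>0$, $c_2>0$ such that, if $c_0\log(n)/n\leq p\leq 1-c_0\log(n)/n$ and $q=1-p$, then with probability at least $1-n^{-c}$, $$c_1\sqrt{(n-k)q/p}\leq \vartheta_k(X^k(n,p))\leq c_2\sqrt{(n-k)q/p}.$$
   Context: The Linial–Meshulam random complex $X^k(n,p)$ is the random simplicial complex on vertex set $V=[n]=\{1,\dots,n\}$ containing all subsets of $[n]$ with at most $k$ elements (complete $(k-1)$-skeleton), in which each $(k+1)$-subset of $[n]$ is included as a $k$-face independently with probability $p=p(n)$. For a simplicial complex $X$ on $[n]$ with set of $k$-faces ($(k+1)$-element faces) $X_k$, define $\vartheta_k(X)$ as follows. For $F=\{x_0<\dots<x_i\}$ and $K\subset F$ with $F\setminus K=\{x_j\}$ set $[F:K]=(-1)^j$; for distinct equal-size $F,F'$ with $|F\cap F'|=|F|-1$ put $\epsilon_{F,F'}=[F:F\cap F'][F':F\cap F']$, otherwise $0$. Let $L^{\downarrow}_{k-1}$ be the matrix indexed by $\binom{[n]}{k}$ with diagonal entries $k$ and off-diagonal entries $\epsilon_{F,F'}$. Then $\vartheta_k(X)$ is the supremum of $\operatorname{trace}(L^{\downarrow}_{k-1}Y)$ over real symmetric positive semidefinite $Y$ indexed by $\binom{[n]}{k}$ with $\operatorname{trace}(Y)=1$, $Y_{F,F'}=0$ whenever $F\cup F'\in X_k$, $Y_{F,F'}=0$ whenever $|F\cup F'|\geq k+2$, and $\epsilon_{F,F'}Y_{F,F'}=\epsilon_{F'',F^\dagger}Y_{F'',F^\dagger}$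 whenever $F\cup F'=F''\cup F^\dagger$ has $k+1$ elements. *)

theory Defs
  imports "HOL-Probability.Probability"
begin

text \<open>
  Faces are finite sets of natural numbers, the vertex set is \<open>{1..n}\<close>, and a matrix
  indexed by a finite family \<open>I\<close> is a function of two arguments that is only ever
  evaluated on \<open>I\<close>.
\<close>

definition subsets_of_size :: "nat \<Rightarrow> nat \<Rightarrow> nat set set" where
  "subsets_of_size n i = {F. F \<subseteq> {1..n} \<and> card F = i}"

text \<open>
  If \<open>F = {x\<^sub>0 < \<dots> < x\<^sub>i}\<close> and \<open>F - K = {x\<^sub>j}\<close>, the index \<open>j\<close> is the number of
  elements of \<open>F\<close> below \<open>x\<^sub>j\<close>. The value is meaningful only if \<open>K \<subset> F\<close> omits exactly
  one element.
\<close>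

definition incidence :: "nat set \<Rightarrow> nat set \<Rightarrow> real" where
  "incidence F K = (- 1) ^ card {y \<in> F. y < the_elem (F - K)}"

definition eps :: "nat set \<Rightarrow> nat set \<Rightarrow> real" where
  "eps F F' =
     (if F \<noteq> F' \<and> card F = card F' \<and> card (F \<inter> F') + 1 = card F
      then incidence F (F \<inter> F') * incidence F' (F \<inter> F') else 0)"

text \<open>The matrix \<open>L\<^sup>\<down>\<close> in dimension \<open>k - 1\<close>, indexed by the \<open>k\<close>-element sets.\<close>

definition L_down :: "nat \<Rightarrow> nat set \<Rightarrow> nat set \<Rightarrow> real" where
  "L_down k F F' = (if F = F' then real k else eps F F')"

definition trace_on :: "'a set \<Rightarrow> ('a \<Rightarrow> 'a \<Rightarrow> real) \<Rightarrow> real" where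
  "trace_on I A = (\<Sum>i\<in>I. A i i)"

definition mat_mult_on ::
    "'a set \<Rightarrow> ('a \<Rightarrow> 'a \<Rightarrow> real) \<Rightarrow> ('a \<Rightarrow> 'a \<Rightarrow> real) \<Rightarrow> 'a \<Rightarrow> 'a \<Rightarrow> real" where
  "mat_mult_on I A B i j = (\<Sum>l\<in>I. A i l * B l j)"

definition sym_psd_on :: "'a set \<Rightarrow> ('a \<Rightarrow> 'a \<Rightarrow> real) \<Rightarrow> bool" where
  "sym_psd_on I A \<longleftrightarrow>
     (\<forall>i\<in>I. \<forall>j\<in>I. A i j = A j i) \<and>
     (\<forall>v. (\<Sum>i\<in>I. \<Sum>j\<in>I. v i * A i j * v j) \<ge> 0)"

definition faces :: "nat \<Rightarrow> nat set set \<Rightarrow> nat set set" where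
  "faces k X = {F \<in> X. card F = k + 1}"

definition theta_feasible ::
    "nat \<Rightarrow> nat \<Rightarrow> nat set set \<Rightarrow> (nat set \<Rightarrow> nat set \<Rightarrow> real) \<Rightarrow> bool" where
  "theta_feasible k n X Y \<longleftrightarrow>
     (let I = subsets_of_size n k in
        sym_psd_on I Y \<and>
        trace_on I Y = 1 \<and>
        (\<forall>F\<in>I. \<forall>F'\<in>I. F \<union> F' \<in> faces k X \<longrightarrow> Y F F' = 0) \<and>
        (\<forall>F\<in>I. \<forall>F'\<in>I. card (F \<union> F') \<ge> k + 2 \<longrightarrow> Y F F' = 0) \<and>
        (\<forall>F\<in>I. \<forall>F'\<in>I. \<forall>G\<in>I. \<forall>G'\<in>I.
           F \<union> F' = G \<union> G' \<and> card (F \<union> F') = k + 1 \<longrightarrow>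
             eps F F' * Y F F' = eps G G' * Y G G'))"

text \<open>
  For \<open>k \<le> n\<close> the set of values is nonempty and bounded above, so the real supremum is
  the genuine one.
\<close>

definition theta :: "nat \<Rightarrow> nat \<Rightarrow> nat set set \<Rightarrow> real" where
  "theta k n X =
     Sup {trace_on (subsets_of_size n k) (mat_mult_on (subsets_of_size n k) (L_down k) Y)
          | Y. theta_feasible k n X Y}"

text \<open>
  The random complex: every set of at most \<open>k\<close> vertices is present (including the empty
  face), and the \<open>(k + 1)\<close>-sets are selected by independent coin flips. The parameter \<open>p\<close>
  is meant to lie in \<open>[0, 1]\<close>.
\<close>

definition linial_meshulam :: "nat \<Rightarrow> nat \<Rightarrow> real \<Rightarrow> nat set set pmf" where
  "linial_meshulam k n p =
     map_pmf (\<lambda>b. {F. F \<subseteq> {1..n} \<and> card F \<le> k} \<union> {F \<in> subsets_of_size n (k + 1). b F})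
       (Pi_pmf (subsets_of_size n (k + 1)) False (\<lambda>_. bernoulli_pmf p))"

end

theory Submission
  imports Defs
begin

text \<open>
  Garland's localisation writes the quadratic form of a matrix with entries
  \<open>\<epsilon>\<^bsub>F,F'\<^esub> \<xi>(F \<union> F')\<close> as a sum, over the \<open>(k - 1)\<close>-sets \<open>\<tau>\<close>, of quadratic forms of the weighted link
  graphs of \<open>\<tau>\<close>. Each link of the random complex is a random graph, so everything reduces to a bound
  \<open>M = C \<surd>(npq)\<close> on the norm of its centred adjacency matrix. Given this bound, testing a feasible \<open>Y\<close>
  against \<open>L\<^sup>\<down>\<close> plus a multiple of the form supported on the faces gives \<open>\<vartheta> \<le> k + k M / p\<close>, and the matrix
  with entries \<open>\<epsilon>\<^bsub>F,F'\<^esub>\<close> on the non-faces and a suitable constant diagonal is feasible and gives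
  \<open>\<vartheta> \<ge> (q (n - k) - M) / (q + M)\<close>.

  The norm bound comes from a trace moment of order \<open>N\<close> between \<open>2npq\<close> and \<open>4npq\<close>. Only closed walks
  traversing every edge at least twice contribute, each with weight at most \<open>(pq)\<^bsup>v - 1\<^esup>\<close> for \<open>v\<close> visited
  vertices. Counting walks of the same shape on \<open>N\<close> vertices turns this into the \<open>N\<close>-th trace moment of a
  dense matrix of size \<open>N\<close>, which a net argument bounds by \<open>(C \<surd>N)\<^bsup>N\<^esup>\<close>. Markov's inequality then loses only
  \<open>n exp(- N)\<close>, so no logarithmic factor appears down to \<open>p\<close> of order \<open>log n / n\<close>.
\<close>

section \<open>Matrix powers and closed walks\<close>

text \<open>The obstacle is the sparse regime. When p has order log n / n, a net argument applied
  directly to a link matrix fails: single entries of size about 1 are far above the scale sqrt(pq),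
  so its linear forms lack the required sub-Gaussian tails. The comparison separates the
  difficulties. The net is used only for a matrix whose entries have constant variance, and the
  trace moment of that matrix does the counting of walks. Its coins have bias 1/3 because 3 (b -
  1/3) takes the values 2 and -1, so that all its moments of order at least 2 are at least 1, odd
  orders included; symmetric signs would lose the walks that use some edge an odd number of times. N
  is a power of two so that repeated Cauchy-Schwarz relates quadratic form and trace. With N about
  npq, the n^v placements of a walk on v vertices, weighted by (pq)^(v-1), are matched by the
  placements on N vertices. The assumption on p gives 2npq >= c0 ln n, so exp(-N) also beats the
  union over at most n^(k-1) links.\<close>

primrec mpow :: "'a set \<Rightarrow> ('a \<Rightarrow> 'a \<Rightarrow> real) \<Rightarrow> nat \<Rightarrow> 'a \<Rightarrow> 'a \<Rightarrow> real" where
  "mpow V A 0 = (\<lambda>x y. of_bool (x = y))"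
| "mpow V A (Suc N) = mat_mult_on V A (mpow V A N)"

definition mat_vec :: "'a set \<Rightarrow> ('a \<Rightarrow> 'a \<Rightarrow> real) \<Rightarrow> ('a \<Rightarrow> real) \<Rightarrow> 'a \<Rightarrow> real" where
  "mat_vec V A f x = (\<Sum>y\<in>V. A x y * f y)"

definition bilin :: "'a set \<Rightarrow> ('a \<Rightarrow> 'a \<Rightarrow> real) \<Rightarrow> ('a \<Rightarrow> real) \<Rightarrow> ('a \<Rightarrow> real) \<Rightarrow> real" where
  "bilin V A f g = (\<Sum>x\<in>V. \<Sum>y\<in>V. f x * A x y * g y)"

lemma bilin_mat_vec: "bilin V A f g = (\<Sum>x\<in>V. f x * mat_vec V A g x)"
  by (simp add: bilin_def mat_vec_def sum_distrib_left mult.assoc)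

lemma mat_mult_on_assoc:
  "mat_mult_on V (mat_mult_on V A B) C = mat_mult_on V A (mat_mult_on V B C)"
proof (intro ext)
  fix x y
  have "mat_mult_on V (mat_mult_on V A B) C x y = (\<Sum>l\<in>V. \<Sum>m\<in>V. A x m * B m l * C l y)"
    by (simp add: mat_mult_on_def sum_distrib_right)
  also have "\<dots> = (\<Sum>m\<in>V. \<Sum>l\<in>V. A x m * B m l * C l y)"
    by (rule sum.swap)
  finally show "mat_mult_on V (mat_mult_on V A B) C x y = mat_mult_on V A (mat_mult_on V B C) x y"
    by (simp add: mat_mult_on_def sum_distrib_left mult.assoc)
qed

lemma mpow_add:
  assumes "finite V" "x \<in> V"
  shows "mpow V A (a + b) x y = (\<Sum>z\<in>V. mpow V A a x z * mpow V A b z y)"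
  using assms(2)
proof (induction a arbitrary: x)
  case 0
  then show ?case using assms(1) by (simp add: of_bool_def sum.delta if_distrib[of "\<lambda>t. t * _"] cong: if_cong)
next
  case (Suc a)
  have "mpow V A (Suc a + b) x y = (\<Sum>l\<in>V. A x l * (\<Sum>z\<in>V. mpow V A a l z * mpow V A b z y))"
    using Suc.IH by (simp add: mat_mult_on_def)
  also have "\<dots> = mat_mult_on V (mat_mult_on V A (mpow V A a)) (mpow V A b) x y"
    unfolding mat_mult_on_assoc by (simp add: mat_mult_on_def)
  finally show ?case by (simp add: mat_mult_on_def)
qed

lemma mpow_sym:
  assumes "finite V" "\<And>x y. x \<in> V \<Longrightarrow> y \<in> V \<Longrightarrow> A x y = A y x" "x \<in> V" "y \<in> V"
  shows "mpow V A N x y = mpow V A N y x"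
  using assms(3,4)
proof (induction N arbitrary: x y)
  case (Suc N)
  have 1: "mpow V A 1 z y = A z y" if "z \<in> V" "y \<in> V" for z y
    using assms(1) that
    by (simp add: mat_mult_on_def of_bool_def if_distrib[of "\<lambda>t. _ * t"] sum.delta' cong: if_cong)
  have "mpow V A (Suc N) x y = (\<Sum>z\<in>V. mpow V A N x z * mpow V A 1 z y)"
    using mpow_add[OF assms(1) Suc.prems(1), of A N 1 y] by simp
  also have "\<dots> = (\<Sum>z\<in>V. mpow V A N x z * A z y)"
    using 1 Suc.prems by (intro sum.cong) auto
  also have "\<dots> = (\<Sum>z\<in>V. A y z * mpow V A N z x)"
    using Suc.IH Suc.prems assms(2) by (intro sum.cong) (auto simp: mult.commute)
  finally show ?case by (simp add: mat_mult_on_def)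
qed auto

lemma mat_vec_mpow_add:
  assumes "finite V" "x \<in> V"
  shows "mat_vec V (mpow V A (a + b)) f x = mat_vec V (mpow V A a) (mat_vec V (mpow V A b) f) x"
proof -
  have "mat_vec V (mpow V A (a + b)) f x = (\<Sum>y\<in>V. \<Sum>z\<in>V. mpow V A a x z * mpow V A b z y * f y)"
    by (simp add: mat_vec_def mpow_add[OF assms] sum_distrib_right)
  also have "\<dots> = (\<Sum>z\<in>V. \<Sum>y\<in>V. mpow V A a x z * mpow V A b z y * f y)"
    by (rule sum.swap)
  finally show ?thesis by (simp add: mat_vec_def sum_distrib_left mult.assoc)
qed

lemma bilin_mpow_double:
  assumes "finite V" "\<And>x y. x \<in> V \<Longrightarrow> y \<in> V \<Longrightarrow> A x y = A y x"
  shows "bilin V (mpow V A (N + N)) f f = (\<Sum>x\<in>V. (mat_vec V (mpow V A N) f x)\<^sup>2)"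
proof -
  let ?B = "mpow V A N" and ?g = "mat_vec V (mpow V A N) f"
  have "bilin V (mpow V A (N + N)) f f = (\<Sum>x\<in>V. f x * mat_vec V ?B ?g x)"
    using mat_vec_mpow_add[OF assms(1)] by (simp add: bilin_mat_vec)
  also have "\<dots> = (\<Sum>x\<in>V. \<Sum>y\<in>V. f x * ?B x y * ?g y)"
    by (simp add: mat_vec_def[of V ?B ?g] sum_distrib_left mult.assoc)
  also have "\<dots> = (\<Sum>y\<in>V. \<Sum>x\<in>V. f x * ?B x y * ?g y)"
    by (rule sum.swap)
  also have "\<dots> = (\<Sum>y\<in>V. \<Sum>x\<in>V. ?B y x * f x * ?g y)"
    using mpow_sym[OF assms] by (intro sum.cong refl) (simp add: mult.commute)
  also have "\<dots> = (\<Sum>y\<in>V. ?g y * ?g y)"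
    by (simp add: mat_vec_def[of V ?B f] sum_distrib_right)
  finally show ?thesis by (simp add: power2_eq_square)
qed

text \<open>By symmetry the trace of an even power is the squared Hilbert-Schmidt norm of half the
  power. Hence it dominates the squared operator norm of that half power, and it is nonnegative, as
  Markov's inequality will need.\<close>

lemma trace_mpow_double:
  assumes "finite V" "\<And>x y. x \<in> V \<Longrightarrow> y \<in> V \<Longrightarrow> A x y = A y x"
  shows "trace_on V (mpow V A (N + N)) = (\<Sum>x\<in>V. \<Sum>y\<in>V. (mpow V A N x y)\<^sup>2)"
  unfolding trace_on_def
  using mpow_add[OF assms(1)] mpow_sym[OF assms]
  by (auto intro!: sum.cong simp: power2_eq_square)

text \<open>
  With \<open>a\<^sub>i = f\<^sup>T A\<^bsup>2^i\<^esup> f\<close> the Cauchy-Schwarz inequality gives \<open>a\<^sub>i\<^sup>2 \<le> |f|\<^sup>2 a\<^bsub>i+1\<^esub>\<close>, which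
  replaces the spectral theorem.
\<close>
lemma quadratic_form_power_le_trace:
  assumes "finite V" "\<And>x y. x \<in> V \<Longrightarrow> y \<in> V \<Longrightarrow> A x y = A y x" and "j \<ge> 1"
  shows "bilin V A f f ^ (2 ^ j) \<le> (\<Sum>x\<in>V. (f x)\<^sup>2) ^ (2 ^ j) * trace_on V (mpow V A (2 ^ j))"
proof -
  define s where "s = (\<Sum>x\<in>V. (f x)\<^sup>2)"
  define a where "a i = bilin V (mpow V A (2 ^ i)) f f" for i
  have s0: "s \<ge> 0" unfolding s_def by (simp add: sum_nonneg)
  have a0: "a 0 = bilin V A f f"
    using assms(1) unfolding a_def bilin_def
    by (auto intro!: sum.cong simp: mat_mult_on_def of_bool_def if_distrib[of "\<lambda>t. _ * t"] sum.delta' cong: if_cong)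
  have dbl: "(2::nat) ^ Suc i = 2 ^ i + 2 ^ i" for i by simp
  have "(bilin V (mpow V A N) f f)\<^sup>2 \<le> s * bilin V (mpow V A (N + N)) f f" for N
    using Cauchy_Schwarz_ineq_sum[of f "mat_vec V (mpow V A N) f" V]
      bilin_mpow_double[OF assms(1,2), where N = N and f = f]
    by (simp add: s_def bilin_mat_vec[of V "mpow V A N"])
  hence step: "(a i)\<^sup>2 \<le> s * a (Suc i)" for i
    unfolding a_def dbl by blast
  show ?thesis
  proof (cases "s = 0")
    case True
    hence "f x = 0" if "x \<in> V" for x
      using that assms(1) unfolding s_def by (simp add: sum_nonneg_eq_0_iff)
    hence "bilin V A f f = 0" by (simp add: bilin_def)
    thus ?thesis using True by (simp add: s_def power_0_left)
  next
    case False
    with s0 have sp: "s > 0" by simp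
    \<comment> \<open>The extra factor \<open>s\<close> on the left avoids the exponent
      \<open>2 ^ i - 1\<close>. Absolute values make it legitimate to square the induction
      hypothesis, since \<open>a 0\<close> may be negative.\<close>
    have claim: "\<bar>s * a 0 ^ (2 ^ i)\<bar> \<le> \<bar>s ^ (2 ^ i) * a i\<bar>" for i
    proof (induction i)
      case (Suc i)
      have sq: "a 0 ^ (2 ^ Suc i) = (a 0 ^ (2 ^ i))\<^sup>2"
        by (metis power_mult power_Suc2)
      have "s * \<bar>s * a 0 ^ (2 ^ Suc i)\<bar> = (s * a 0 ^ (2 ^ i))\<^sup>2"
        using sp sq by (simp add: abs_mult power_mult_distrib power2_eq_square)
      also have "\<dots> \<le> (s ^ (2 ^ i) * a i)\<^sup>2"
        using power_mono[OF Suc.IH, of 2] by simp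
      also have "\<dots> = s ^ (2 ^ Suc i) * (a i)\<^sup>2"
        by (simp add: power_mult_distrib mult.commute flip: power_mult)
      also have "\<dots> \<le> s ^ (2 ^ Suc i) * (s * a (Suc i))"
        using step[of i] sp by (intro mult_left_mono) auto
      also have "\<dots> \<le> s * \<bar>s ^ (2 ^ Suc i) * a (Suc i)\<bar>"
        using sp by (simp add: abs_mult)
      finally show ?case using sp by simp
    qed simp
    obtain i where i: "j = Suc i" using assms(3) by (cases j) auto
    let ?B = "mpow V A (2 ^ i)"
    \<comment> \<open>The last doubling is done differently: \<open>a j\<close> is the squared norm
      of half the power applied to \<open>f\<close>, hence at most \<open>s\<close> times a squared
      Hilbert-Schmidt norm, which is the trace.\<close>
    have aj: "a j = (\<Sum>x\<in>V. (mat_vec V ?B f x)\<^sup>2)"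
      unfolding a_def i dbl by (rule bilin_mpow_double[OF assms(1,2)])
    also have "\<dots> \<le> (\<Sum>x\<in>V. (\<Sum>y\<in>V. (?B x y)\<^sup>2) * s)"
      unfolding s_def mat_vec_def by (intro sum_mono Cauchy_Schwarz_ineq_sum)
    also have "\<dots> = s * trace_on V (mpow V A (2 ^ j))"
      unfolding i dbl using trace_mpow_double[OF assms(1,2), where N = "2 ^ i"]
      by (simp add: sum_distrib_left mult.commute)
    finally have le: "a j \<le> s * trace_on V (mpow V A (2 ^ j))" .
    have "a j \<ge> 0" using aj by (simp add: sum_nonneg)
    hence "s * a 0 ^ (2 ^ j) \<le> s ^ (2 ^ j) * a j"
      using claim[of j] sp abs_ge_self[of "s * a 0 ^ (2 ^ j)"] by (simp add: abs_of_nonneg[of "s ^ (2 ^ j) * a j"] del: abs_ge_self)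
    also have "\<dots> \<le> s ^ (2 ^ j) * (s * trace_on V (mpow V A (2 ^ j)))"
      using le sp by (intro mult_left_mono) auto
    finally show ?thesis using sp unfolding a0 s_def[symmetric] by (simp add: mult.left_commute)
  qed
qed

text \<open>A bound on the bilinear form is an operator norm bound: testing it at
  \<open>f = A g\<close> gives |A g| <= B |g|, which is iterated. Each diagonal entry of the power
  is a coordinate of the power applied to a unit vector.\<close>

lemma trace_mpow_le:
  assumes "finite V" "B \<ge> 0"
    and B: "\<And>f g. bilin V A f g \<le> B * (L2_set f V * L2_set g V)"
  shows "trace_on V (mpow V A N) \<le> real (card V) * B ^ N"
proof -
  have mv: "L2_set (mat_vec V A g) V \<le> B * L2_set g V" for g
  proof -
    let ?h = "mat_vec V A g"
    have "(L2_set ?h V)\<^sup>2 = bilin V A ?h g"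
      by (simp add: L2_set_def sum_nonneg bilin_mat_vec power2_eq_square)
    also have "\<dots> \<le> B * (L2_set ?h V * L2_set g V)" by (rule B)
    finally have "L2_set ?h V * L2_set ?h V \<le> L2_set ?h V * (B * L2_set g V)"
      by (simp add: power2_eq_square mult_ac)
    thus ?thesis
      using mult_le_cancel_left_pos[of "L2_set ?h V"] L2_set_nonneg[of ?h V] assms(2) L2_set_nonneg[of g V]
      by (cases "L2_set ?h V = 0") auto
  qed
  have pw: "L2_set (mat_vec V (mpow V A N) g) V \<le> B ^ N * L2_set g V" for g
  proof (induction N)
    case 0
    have "L2_set (mat_vec V (mpow V A 0) g) V = L2_set g V"
      using assms(1) by (intro L2_set_cong) (auto simp: mat_vec_def of_bool_def if_distrib[of "\<lambda>t. t * _"] sum.delta cong: if_cong)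
    thus ?case by simp
  next
    case (Suc N)
    have "mat_vec V (mpow V A (Suc N)) g x = mat_vec V A (mat_vec V (mpow V A N) g) x" for x
    proof -
      have "mat_vec V (mpow V A (Suc N)) g x = (\<Sum>y\<in>V. \<Sum>z\<in>V. A x z * mpow V A N z y * g y)"
        by (simp add: mat_vec_def mat_mult_on_def sum_distrib_right)
      also have "\<dots> = (\<Sum>z\<in>V. \<Sum>y\<in>V. A x z * mpow V A N z y * g y)" by (rule sum.swap)
      finally show ?thesis by (simp add: mat_vec_def sum_distrib_left mult.assoc)
    qed
    hence "L2_set (mat_vec V (mpow V A (Suc N)) g) V = L2_set (mat_vec V A (mat_vec V (mpow V A N) g)) V"
      by presburger
    also have "\<dots> \<le> B * (B ^ N * L2_set g V)"
      using mv Suc.IH assms(2) by (meson mult_left_mono order_trans)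
    finally show ?case by (simp add: mult.assoc)
  qed
  have "mpow V A N x x \<le> B ^ N" if "x \<in> V" for x
  proof -
    define e where "e y = (of_bool (y = x) :: real)" for y
    have "mat_vec V (mpow V A N) e x = mpow V A N x x"
      using assms(1) that by (simp add: mat_vec_def e_def of_bool_def if_distrib[of "\<lambda>t. _ * t"] sum.delta cong: if_cong)
    hence "mpow V A N x x \<le> L2_set (mat_vec V (mpow V A N) e) V"
      by (smt (verit, best) assms(1) member_le_L2_set that L2_set_nonneg L2_set_def real_sqrt_abs real_sqrt_le_iff member_le_sum zero_le_power2)
    also have "\<dots> \<le> B ^ N * L2_set e V" by (rule pw)
    also have "L2_set e V = 1"
      using assms(1) that unfolding L2_set_def e_def
      by (simp add: of_bool_def if_distrib[of "\<lambda>t. t ^ 2"] sum.delta cong: if_cong)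
    finally show ?thesis by simp
  qed
  hence "trace_on V (mpow V A N) \<le> (\<Sum>x\<in>V. B ^ N)"
    unfolding trace_on_def by (intro sum_mono) auto
  thus ?thesis by simp
qed

section \<open>Expansion of matrix powers and traces over walks\<close>

definition walks :: "'a set \<Rightarrow> nat \<Rightarrow> 'a list set" where
  "walks V N = {w. set w \<subseteq> V \<and> length w = Suc N}"

lemma finite_walks: "finite V \<Longrightarrow> finite (walks V N)"
  unfolding walks_def by (rule finite_lists_length_eq)

lemma mpow_eq_sum_walks:
  assumes "finite V" "x \<in> V" "y \<in> V"
  shows "mpow V A N x y = (\<Sum>w | w \<in> walks V N \<and> w ! 0 = x \<and> w ! N = y. \<Prod>t<N. A (w ! t) (w ! Suc t))"
  using assms(2)
proof (induction N arbitrary: x)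
  case 0
  have "{w. w \<in> walks V 0 \<and> w ! 0 = x \<and> w ! 0 = y} = (if x = y then {[x]} else {})"
    using 0 by (auto simp: walks_def length_Suc_conv)
  thus ?case by simp
next
  case (Suc N)
  let ?W = "\<lambda>N x. {w. w \<in> walks V N \<and> w ! 0 = x \<and> w ! N = y}"
  have "mpow V A (Suc N) x y = (\<Sum>z\<in>V. \<Sum>w\<in>?W N z. A x z * (\<Prod>t<N. A (w ! t) (w ! Suc t)))"
    using Suc.IH by (simp add: mat_mult_on_def sum_distrib_left)
  also have "\<dots> = (\<Sum>(z, w)\<in>Sigma V (?W N). A x z * (\<Prod>t<N. A (w ! t) (w ! Suc t)))"
    using assms(1) finite_walks[OF assms(1), of N] by (intro sum.Sigma) auto
  also have "\<dots> = (\<Sum>w\<in>?W (Suc N) x. \<Prod>t<Suc N. A (w ! t) (w ! Suc t))"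
  proof (rule sum.reindex_bij_witness[of _ "\<lambda>w. (w ! 1, tl w)" "\<lambda>(z, w). x # w"])
    fix zw assume "zw \<in> Sigma V (?W N)"
    then obtain z w where zw: "zw = (z, w)" "w \<in> walks V N" "w ! 0 = z" "w ! N = y" by auto
    show "((case zw of (z, w) \<Rightarrow> x # w) ! 1, tl (case zw of (z, w) \<Rightarrow> x # w)) = zw"
      using zw by simp
    show "(case zw of (z, w) \<Rightarrow> x # w) \<in> ?W (Suc N) x"
      using zw Suc.prems by (auto simp: walks_def)
    show "(\<Prod>t<Suc N. A ((case zw of (z, w) \<Rightarrow> x # w) ! t) ((case zw of (z, w) \<Rightarrow> x # w) ! Suc t)) =
        (case zw of (z, w) \<Rightarrow> A x z * (\<Prod>t<N. A (w ! t) (w ! Suc t)))"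
      using zw by (simp add: prod.lessThan_Suc_shift del: prod.lessThan_Suc)
  next
    fix w assume "w \<in> ?W (Suc N) x"
    then obtain w' where w': "w = x # w'" "length w' = Suc N" "set w' \<subseteq> V" "w' ! N = y"
      by (cases w) (auto simp: walks_def)
    thus "(case (w ! 1, tl w) of (z, w) \<Rightarrow> x # w) = w" by simp
    show "(w ! 1, tl w) \<in> Sigma V (?W N)"
      using w' nth_mem[of 0 w'] by (auto simp: walks_def)
  qed
  finally show ?case .
qed

definition closed_walks :: "'a set \<Rightarrow> nat \<Rightarrow> 'a list set" where
  "closed_walks V N = {w \<in> walks V N. w ! 0 = w ! N}"

lemma finite_closed_walks: "finite V \<Longrightarrow> finite (closed_walks V N)"
  using finite_walks[of V N] by (auto simp: closed_walks_def)

lemma trace_mpow_eq_sum_closed_walks: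
  assumes "finite V"
  shows "trace_on V (mpow V A N) = (\<Sum>w\<in>closed_walks V N. \<Prod>t<N. A (w ! t) (w ! Suc t))"
proof -
  have "trace_on V (mpow V A N) =
      (\<Sum>x\<in>V. \<Sum>w | w \<in> closed_walks V N \<and> w ! 0 = x. \<Prod>t<N. A (w ! t) (w ! Suc t))"
    unfolding trace_on_def by (intro sum.cong refl, subst mpow_eq_sum_walks[OF assms])
      (auto simp: closed_walks_def intro!: sum.cong)
  also have "\<dots> = (\<Sum>w\<in>closed_walks V N. \<Prod>t<N. A (w ! t) (w ! Suc t))"
    using assms finite_closed_walks[OF assms, of N]
    by (intro sum.group) (auto simp: closed_walks_def walks_def)
  finally show ?thesis .
qed

section \<open>Comparison of closed walks on vertex sets of different sizes\<close>

text \<open>The closed walks that can survive taking expectations: a loop meets the zero diagonal,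
  and an edge used once contributes a first central moment, which is 0.\<close>

definition good_walks :: "'a set \<Rightarrow> nat \<Rightarrow> 'a list set" where
  "good_walks V N = {w \<in> closed_walks V N. \<forall>t<N. w ! t \<noteq> w ! Suc t \<and>
     (\<exists>s<N. s \<noteq> t \<and> {w ! s, w ! Suc s} = {w ! t, w ! Suc t})}"

lemma finite_good_walks: "finite V \<Longrightarrow> finite (good_walks V N)"
  using finite_closed_walks[of V N] by (simp add: good_walks_def)

text \<open>The steps form a connected graph. Along the walk, a vertex that is new must be reached
  through an edge that is new.\<close>

lemma card_vertices_le_edges:
  assumes "length w = Suc N"
  shows "card (set w) \<le> card ((\<lambda>t. {w ! t, w ! Suc t}) ` {..<N}) + 1"
proof -
  let ?e = "\<lambda>t. {w ! t, w ! Suc t}"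
  have "card (set (take (Suc t) w)) \<le> card (?e ` {..<t}) + 1" if "t \<le> N" for t
    using that
  proof (induction t)
    case 0
    thus ?case using assms by (cases w) auto
  next
    case (Suc t)
    have eq: "set (take (Suc (Suc t)) w) = insert (w ! Suc t) (set (take (Suc t) w))"
      using Suc.prems assms by (simp add: take_Suc_conv_app_nth insert_commute)
    have mono: "card (?e ` {..<t}) \<le> card (?e ` {..<Suc t})"
      by (intro card_mono) auto
    show ?case
    proof (cases "w ! Suc t \<in> set (take (Suc t) w)")
      case True
      thus ?thesis using eq Suc mono by (simp add: insert_absorb)
    next
      case False
      have "w ! s \<in> set (take (Suc t) w)" if "s \<le> t" for s
        using that Suc.prems assms by (auto simp: in_set_conv_nth intro!: exI[of _ s])
      hence "w ! s \<noteq> w ! Suc t \<and> w ! Suc s \<noteq> w ! Suc t" if "s < t" for s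
        using False that by (metis Suc_leI less_imp_le)
      hence "?e t \<noteq> ?e s" if "s < t" for s
        using that by (metis insertCI insertE singletonD)
      hence "?e t \<notin> ?e ` {..<t}" by (metis (no_types, lifting) imageE lessThan_iff)
      hence "card (?e ` {..<Suc t}) = Suc (card (?e ` {..<t}))"
        by (simp add: lessThan_Suc)
      thus ?thesis using eq Suc False by simp
    qed
  qed
  from this[of N] show ?thesis using assms by simp
qed

text \<open>Grouping the \<open>N\<close> steps by undirected edge, every class has at least two
  members.\<close>

lemma good_walks_card_edges:
  assumes "w \<in> good_walks V N"
  shows "2 * card ((\<lambda>t. {w ! t, w ! Suc t}) ` {..<N}) \<le> N"
proof -
  let ?e = "\<lambda>t. {w ! t, w ! Suc t}"
  have "2 \<le> card {t \<in> {..<N}. ?e t = i}" if "i \<in> ?e ` {..<N}" for i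
  proof -
    from that obtain t where t: "t < N" "i = ?e t" by auto
    have "\<exists>s<N. s \<noteq> t \<and> ?e s = ?e t"
      using assms t(1) unfolding good_walks_def by blast
    then obtain s where s: "s < N" "s \<noteq> t" "?e s = ?e t" by blast
    hence "{s, t} \<subseteq> {t \<in> {..<N}. ?e t = i}" using t by auto
    hence "card {s, t} \<le> card {t \<in> {..<N}. ?e t = i}" by (intro card_mono) auto
    thus ?thesis using s by simp
  qed
  hence "(\<Sum>i\<in>?e ` {..<N}. 2) \<le> (\<Sum>i\<in>?e ` {..<N}. card {t \<in> {..<N}. ?e t = i})"
    by (intro sum_mono) auto
  also have "\<dots> = N"
    using sum.image_gen[of "{..<N}" "\<lambda>_. 1 :: nat" ?e] by simp
  finally show ?thesis by simp
qed

lemma good_walks_card_vertices: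
  assumes "w \<in> good_walks V (2 * l)"
  shows "card (set w) \<le> l + 1" "card (set w) \<ge> 1"
proof -
  have len: "length w = Suc (2 * l)"
    using assms by (simp add: good_walks_def closed_walks_def walks_def)
  show "card (set w) \<le> l + 1"
    using card_vertices_le_edges[OF len] good_walks_card_edges[OF assms] by simp
  show "card (set w) \<ge> 1" using len by (cases w) (auto simp: Suc_le_eq card_gt_0_iff)
qed

lemma good_walks_map:
  assumes "w \<in> good_walks V N" "inj_on \<phi> (set w)" "\<phi> ` set w \<subseteq> U"
  shows "map \<phi> w \<in> good_walks U N"
proof -
  have w: "length w = Suc N" "w ! 0 = w ! N" "set w \<subseteq> V"
    using assms(1) by (auto simp: good_walks_def closed_walks_def walks_def)
  have nth: "w ! t \<in> set w" if "t \<le> N" for t using that w by simp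
  have "map \<phi> w ! t \<noteq> map \<phi> w ! Suc t \<and>
      (\<exists>s<N. s \<noteq> t \<and> {map \<phi> w ! s, map \<phi> w ! Suc s} = {map \<phi> w ! t, map \<phi> w ! Suc t})" if t: "t < N" for t
  proof -
    from assms(1) t obtain s where s: "w ! t \<noteq> w ! Suc t" "s < N" "s \<noteq> t"
        "{w ! s, w ! Suc s} = {w ! t, w ! Suc t}"
      unfolding good_walks_def by blast
    have "\<phi> ` {w ! s, w ! Suc s} = \<phi> ` {w ! t, w ! Suc t}" using s by simp
    moreover have "\<phi> (w ! t) \<noteq> \<phi> (w ! Suc t)"
      using s(1) assms(2) nth[of t] nth[of "Suc t"] t by (auto simp: inj_on_def)
    moreover have "map \<phi> w ! i = \<phi> (w ! i)" if "i \<le> N" for i using that w by simp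
    ultimately show ?thesis using s(2,3) t by (intro conjI exI[of _ s]) (simp_all add: Suc_le_eq)
  qed
  thus ?thesis using w assms(3) by (auto simp: good_walks_def closed_walks_def walks_def)
qed

text \<open>Walks on two vertex sets are compared directly through an injective relabelling, so no
  canonical representative of a shape has to be chosen.\<close>

definition same_shape :: "'a list \<Rightarrow> 'b list \<Rightarrow> bool" where
  "same_shape w u \<longleftrightarrow> (\<exists>\<phi>. inj_on \<phi> (set w) \<and> u = map \<phi> w)"

lemma same_shape_card: "same_shape w u \<Longrightarrow> card (set u) = card (set w)"
  by (auto simp: same_shape_def card_image)

text \<open>The injective relabellings of \<open>w\<close> are counted by a falling factorial of
  \<open>card U\<close>. It has at most \<open>l + 1\<close> factors because \<open>w\<close> is
  good, so each factor is at least \<open>2 * l - l\<close>.\<close>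

lemma card_same_shape_ge:
  assumes "finite U" "2 * l \<le> card U" "w \<in> good_walks V (2 * l)"
  shows "l ^ card (set w) \<le> card {u \<in> good_walks U (2 * l). same_shape w u}"
proof -
  let ?v = "card (set w)"
  have "l ^ ?v = (\<Prod>i\<in>{0..<?v}. l)" by simp
  also have "\<dots> \<le> (\<Prod>i\<in>{0..<?v}. card U - i)"
    using good_walks_card_vertices[OF assms(3)] assms(2) by (intro prod_mono) auto
  also have "\<dots> = card {\<phi> \<in> set w \<rightarrow>\<^sub>E U. inj_on \<phi> (set w)}"
    using card_inj_on_subset_funcset[of "set w" U "set w"] assms(1) by simp
  also have "\<dots> = card ((\<lambda>\<phi>. map \<phi> w) ` {\<phi> \<in> set w \<rightarrow>\<^sub>E U. inj_on \<phi> (set w)})"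
  proof (rule card_image[symmetric], rule inj_onI)
    fix \<phi> \<psi> assume "\<phi> \<in> {\<phi> \<in> set w \<rightarrow>\<^sub>E U. inj_on \<phi> (set w)}" "\<psi> \<in> {\<phi> \<in> set w \<rightarrow>\<^sub>E U. inj_on \<phi> (set w)}"
      and eq: "map \<phi> w = map \<psi> w"
    hence "\<phi> \<in> set w \<rightarrow>\<^sub>E U" "\<psi> \<in> set w \<rightarrow>\<^sub>E U" by auto
    thus "\<phi> = \<psi>" by (rule PiE_ext) (use eq in simp)
  qed
  also have "\<dots> \<le> card {u \<in> good_walks U (2 * l). same_shape w u}"
  proof (rule card_mono)
    show "finite {u \<in> good_walks U (2 * l). same_shape w u}"
      using finite_good_walks[OF assms(1), of "2 * l"] by simp
    have "map \<phi> w \<in> good_walks U (2 * l) \<and> same_shape w (map \<phi> w)"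
      if "\<phi> \<in> set w \<rightarrow>\<^sub>E U" "inj_on \<phi> (set w)" for \<phi>
      using good_walks_map[OF assms(3) that(2)] that by (auto simp: same_shape_def)
    thus "(\<lambda>\<phi>. map \<phi> w) ` {\<phi> \<in> set w \<rightarrow>\<^sub>E U. inj_on \<phi> (set w)}
        \<subseteq> {u \<in> good_walks U (2 * l). same_shape w u}" by blast
  qed
  finally show ?thesis .
qed

text \<open>A walk of the shape of \<open>u\<close> is recovered from \<open>u\<close> by the
  inverse relabelling, so it is an image of \<open>u\<close> under some map into
  \<open>V\<close>.\<close>

lemma card_same_shape_le:
  assumes "finite V"
  shows "card {w \<in> good_walks V N. same_shape w u} \<le> card V ^ card (set u)"
proof -
  have "{w \<in> good_walks V N. same_shape w u} \<subseteq> (\<lambda>\<psi>. map \<psi> u) ` (set u \<rightarrow>\<^sub>E V)"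
  proof safe
    fix w assume w: "w \<in> good_walks V N" "same_shape w u"
    then obtain \<phi> where \<phi>: "inj_on \<phi> (set w)" "u = map \<phi> w" by (auto simp: same_shape_def)
    let ?\<psi> = "restrict (the_inv_into (set w) \<phi>) (set u)"
    have "set w \<subseteq> V" using w(1) by (simp add: good_walks_def closed_walks_def walks_def)
    hence "?\<psi> \<in> set u \<rightarrow>\<^sub>E V" using \<phi> by (auto simp: the_inv_into_f_f)
    moreover have "w = map ?\<psi> u"
      using \<phi> by (simp add: the_inv_into_f_f map_idI)
    ultimately show "w \<in> (\<lambda>\<psi>. map \<psi> u) ` (set u \<rightarrow>\<^sub>E V)" by blast
  qed
  hence "card {w \<in> good_walks V N. same_shape w u} \<le> card (set u \<rightarrow>\<^sub>E V)"
    using assms by (meson card_image_le card_mono finite_PiE finite_imageI finite_set order_trans)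
  thus ?thesis by (simp add: card_funcsetE)
qed

text \<open>
  Double counting of pairs of walks of the same shape. It transfers the weight of sparse walks on
  \<open>V\<close> to a mere count of walks on a vertex set \<open>U\<close> whose size is comparable to \<open>|V| s\<close>.
\<close>
lemma good_walks_comparison:
  assumes "finite V" "finite U" "2 * l \<le> card U" "l \<ge> 1" "s \<ge> 0" "real (card V) * s \<le> real l"
  shows "(\<Sum>w\<in>good_walks V (2 * l). s ^ (card (set w) - 1))
    \<le> real (card V) / real l * real (card (good_walks U (2 * l)))"
proof -
  let ?V = "good_walks V (2 * l)" and ?U = "good_walks U (2 * l)"
  \<comment> \<open>The weight s^(v-1) of a walk \<open>w\<close> is shared out among the walks
    \<open>u\<close> of the same shape. There are at least l^v of them, so a share of
    \<open>?h v\<close> each is enough.\<close>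
  let ?h = "\<lambda>v. s ^ (v - 1) / real l ^ v"
  have fin: "finite ?V" "finite ?U" using finite_good_walks assms by auto
  have "(\<Sum>w\<in>?V. s ^ (card (set w) - 1)) \<le> (\<Sum>w\<in>?V. \<Sum>u | u \<in> ?U \<and> same_shape w u. ?h (card (set u)))"
  proof (rule sum_mono)
    fix w assume w: "w \<in> ?V"
    let ?v = "card (set w)"
    have "s ^ (?v - 1) = ?h ?v * real (l ^ ?v)" using assms(4) by simp
    also have "\<dots> \<le> ?h ?v * real (card {u \<in> ?U. same_shape w u})"
      using card_same_shape_ge[OF assms(2,3) w] assms(5) by (intro mult_left_mono) auto
    also have "\<dots> = (\<Sum>u | u \<in> ?U \<and> same_shape w u. ?h ?v)" by simp
    also have "\<dots> = (\<Sum>u | u \<in> ?U \<and> same_shape w u. ?h (card (set u)))"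
      by (intro sum.cong) (auto simp: same_shape_card)
    finally show "s ^ (?v - 1) \<le> (\<Sum>u | u \<in> ?U \<and> same_shape w u. ?h (card (set u)))" .
  qed
  also have "\<dots> = (\<Sum>u\<in>?U. \<Sum>w | w \<in> ?V \<and> same_shape w u. ?h (card (set u)))"
    by (rule sum.swap_restrict[OF fin])
  also have "\<dots> \<le> (\<Sum>u\<in>?U. real (card V) / real l)"
  proof (rule sum_mono)
    fix u assume u: "u \<in> ?U"
    obtain v where v: "card (set u) = Suc v"
      using good_walks_card_vertices(2)[OF u] by (metis Suc_le_D One_nat_def)
    have "(\<Sum>w | w \<in> ?V \<and> same_shape w u. ?h (card (set u)))
        = real (card {w \<in> ?V. same_shape w u}) * ?h (Suc v)" by (simp add: v)
    also have "\<dots> \<le> real (card V ^ Suc v) * ?h (Suc v)"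
      using card_same_shape_le[OF assms(1), of "2 * l" u] assms(5)
      by (intro mult_right_mono) (auto simp: v simp del: power_Suc of_nat_power)
    \<comment> \<open>A fixed \<open>u\<close> collects |V|/l times a power of |V| s / l. The
      assumption on \<open>s\<close> says exactly that this ratio is at most 1, so the shape of
      \<open>u\<close> no longer matters.\<close>
    also have "\<dots> = real (card V) / real l * (real (card V) * s / real l) ^ v"
      by (simp add: power_mult_distrib power_divide)
    also have "\<dots> \<le> real (card V) / real l * 1"
      using assms by (intro mult_left_mono power_le_one) auto
    finally show "(\<Sum>w | w \<in> ?V \<and> same_shape w u. ?h (card (set u))) \<le> real (card V) / real l" by simp
  qed
  finally show ?thesis by (simp add: mult.commute)
qed

section \<open>Trace moments of centred random adjacency matrices\<close>

lemma expectation_prod_Pi_pmf_finite: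
  fixes f :: "'i \<Rightarrow> 'v \<Rightarrow> real"
  assumes "finite I" "\<And>i. i \<in> I \<Longrightarrow> finite (set_pmf (p i))"
  shows "measure_pmf.expectation (Pi_pmf I dflt p) (\<lambda>\<beta>. \<Prod>i\<in>I. f i (\<beta> i)) =
    (\<Prod>i\<in>I. measure_pmf.expectation (p i) (f i))"
proof -
  let ?M = "measure_pmf (Pi_pmf I dflt p)"
  have comp: "map_pmf (\<lambda>\<beta>. \<beta> i) (Pi_pmf I dflt p) = p i" if "i \<in> I" for i
    using Pi_pmf_component[OF assms(1), of i dflt p] that by simp
  have "prob_space.indep_vars ?M (\<lambda>_. borel) (\<lambda>i \<beta>. f i (\<beta> i)) I"
    using prob_space.indep_vars_compose2[OF measure_pmf.prob_space_axioms indep_vars_Pi_pmf[OF assms(1), of dflt p],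
        where Y = f and N = "\<lambda>_. borel"] by simp
  moreover have "integrable ?M (\<lambda>\<beta>. f i (\<beta> i))" if "i \<in> I" for i
  proof -
    have "integrable (measure_pmf (p i)) (f i)"
      using assms(2)[OF that] by (rule integrable_measure_pmf_finite)
    thus ?thesis using comp[OF that] integrable_map_pmf_eq[of "\<lambda>\<beta>. \<beta> i" "Pi_pmf I dflt p" "f i"] by simp
  qed
  ultimately have "measure_pmf.expectation (Pi_pmf I dflt p) (\<lambda>\<beta>. \<Prod>i\<in>I. f i (\<beta> i)) =
      (\<Prod>i\<in>I. measure_pmf.expectation (Pi_pmf I dflt p) (\<lambda>\<beta>. f i (\<beta> i)))"
    using assms(1) by (intro prob_space.indep_vars_lebesgue_integral[OF measure_pmf.prob_space_axioms])
  also have "\<dots> = (\<Prod>i\<in>I. measure_pmf.expectation (p i) (f i))"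
  proof (rule prod.cong[OF refl])
    fix i assume "i \<in> I"
    have "measure_pmf.expectation (map_pmf (\<lambda>\<beta>. \<beta> i) (Pi_pmf I dflt p)) (f i)
        = measure_pmf.expectation (Pi_pmf I dflt p) (\<lambda>\<beta>. f i (\<beta> i))" by simp
    thus "measure_pmf.expectation (Pi_pmf I dflt p) (\<lambda>\<beta>. f i (\<beta> i)) = measure_pmf.expectation (p i) (f i)"
      by (simp only: comp[OF \<open>i \<in> I\<close>])
  qed
  finally show ?thesis .
qed

definition central_moment :: "real \<Rightarrow> nat \<Rightarrow> real" where
  "central_moment p m = p * (1 - p) ^ m + (1 - p) * (- p) ^ m"

lemma central_moment_0 [simp]: "central_moment p 0 = 1"
  and central_moment_1 [simp]: "central_moment p (Suc 0) = 0"
  by (simp_all add: central_moment_def algebra_simps)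

text \<open>A centred coin is bounded by 1 in absolute value, so all higher moments are dominated by
  the variance.\<close>

lemma central_moment_bound:
  assumes "0 \<le> p" "p \<le> 1" "m \<ge> 2"
  shows "\<bar>central_moment p m\<bar> \<le> p * (1 - p)"
proof -
  obtain i where m: "m = i + 2" using assms(3) by (metis add.commute le_Suc_ex)
  have *: "\<bar>a * b ^ m\<bar> \<le> a * b\<^sup>2" if "a \<ge> 0" "\<bar>b\<bar> \<le> 1" for a b :: real
  proof -
    have "\<bar>b\<bar> ^ i * b\<^sup>2 \<le> 1 * b\<^sup>2" using that by (intro mult_right_mono power_le_one) auto
    hence "a * (\<bar>b\<bar> ^ i * b\<^sup>2) \<le> a * b\<^sup>2" using that(1) by (intro mult_left_mono) auto
    thus ?thesis using that by (simp add: m abs_mult power_add power_abs power2_eq_square mult_ac)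
  qed
  have "\<bar>central_moment p m\<bar> \<le> p * (1 - p)\<^sup>2 + (1 - p) * (- p)\<^sup>2"
    unfolding central_moment_def using *[of p "1 - p"] *[of "1 - p" "- p"] assms(1,2)
    by (intro abs_triangle_ineq[THEN order_trans] add_mono) auto
  also have "\<dots> = p * (1 - p)" by (simp add: power2_eq_square algebra_simps)
  finally show ?thesis .
qed

text \<open>The scaled coin equals 2 with probability 1/3 and -1 with probability 2/3, so its
  moments are (2^m + 2 (-1)^m) / 3. This turns the expected trace into an upper bound for the number
  of good walks.\<close>

lemma central_moment_third:
  assumes "m \<ge> 2"
  shows "3 ^ m * central_moment (1/3) m \<ge> 1"
proof -
  have "3 ^ m * central_moment (1/3) m = (2 ^ m + 2 * (- 1) ^ m) / 3"
    by (simp add: central_moment_def power_divide field_simps flip: power_mult_distrib)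
  moreover have "2 ^ m + 2 * (- 1) ^ m \<ge> (3 :: real)"
  proof (cases "even m")
    case True
    have "(2::real) ^ m \<ge> 2 ^ 2" using assms by (intro power_increasing) auto
    thus ?thesis using True by simp
  next
    case False
    hence "m \<ge> 3" using assms by (cases "m = 2") auto
    hence "(2::real) ^ m \<ge> 2 ^ 3" by (intro power_increasing) auto
    thus ?thesis using False by simp
  qed
  ultimately show ?thesis by simp
qed

definition centred_adj :: "real \<Rightarrow> ('v \<Rightarrow> 'v \<Rightarrow> 'i) \<Rightarrow> ('i \<Rightarrow> bool) \<Rightarrow> 'v \<Rightarrow> 'v \<Rightarrow> real" where
  "centred_adj p g \<beta> x y = (if x = y then 0 else of_bool (\<beta> (g x y)) - p)"

text \<open>Abstracting from the index set of the coins lets one trace computation serve the links,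
  where the coin of an edge is a (k+1)-set, and the dense model, where it is a pair of
  numbers.\<close>

definition edge_labelling :: "'v set \<Rightarrow> 'i set \<Rightarrow> ('v \<Rightarrow> 'v \<Rightarrow> 'i) \<Rightarrow> bool" where
  "edge_labelling V I g \<longleftrightarrow>
     (\<forall>x\<in>V. \<forall>y\<in>V. x \<noteq> y \<longrightarrow> g x y \<in> I) \<and>
     (\<forall>x\<in>V. \<forall>y\<in>V. \<forall>x'\<in>V. \<forall>y'\<in>V. x \<noteq> y \<longrightarrow> x' \<noteq> y' \<longrightarrow> (g x y = g x' y' \<longleftrightarrow> {x, y} = {x', y'}))"

abbreviation coins :: "'i set \<Rightarrow> real \<Rightarrow> ('i \<Rightarrow> bool) pmf" where
  "coins I p \<equiv> Pi_pmf I False (\<lambda>_. bernoulli_pmf p)"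

lemma finite_set_coins: "finite I \<Longrightarrow> finite (set_pmf (coins I p))"
  by (auto simp: set_Pi_pmf intro!: finite_PiE_dflt)

lemma centred_adj_sym:
  assumes "edge_labelling V I g" "x \<in> V" "y \<in> V"
  shows "centred_adj p g \<beta> x y = centred_adj p g \<beta> y x"
proof (cases "x = y")
  case False
  hence "g x y = g y x" using assms unfolding edge_labelling_def by (auto simp: insert_commute)
  thus ?thesis by (auto simp: centred_adj_def)
qed simp

definition walk_label :: "('v \<Rightarrow> 'v \<Rightarrow> 'i) \<Rightarrow> 'v list \<Rightarrow> nat \<Rightarrow> 'i" where
  "walk_label g w t = g (w ! t) (w ! Suc t)"

lemma edge_labelling_eq_iff:
  assumes "edge_labelling V I g" "x \<in> V" "y \<in> V" "x' \<in> V" "y' \<in> V" "x \<noteq> y" "x' \<noteq> y'"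
  shows "g x y = g x' y' \<longleftrightarrow> {x, y} = {x', y'}"
  using assms by (simp add: edge_labelling_def)

context
  fixes V :: "'v set" and I :: "'i set" and g :: "'v \<Rightarrow> 'v \<Rightarrow> 'i" and p :: real and N :: nat
  assumes V: "finite V" and I: "finite I" and g: "edge_labelling V I g" and p: "0 \<le> p" "p \<le> 1"
begin

text \<open>Steps with the same label share one coin. The product is regrouped by coins, which are
  independent; coins that are not visited have exponent 0 and contribute 1.\<close>

lemma expectation_walk:
  assumes "w \<in> closed_walks V N" "\<And>t. t < N \<Longrightarrow> w ! t \<noteq> w ! Suc t"
  shows "measure_pmf.expectation (coins I p) (\<lambda>\<beta>. \<Prod>t<N. centred_adj p g \<beta> (w ! t) (w ! Suc t)) =
    (\<Prod>i\<in>walk_label g w ` {..<N}. central_moment p (card {t \<in> {..<N}. walk_label g w t = i}))"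
proof -
  let ?m = "\<lambda>i. card {t \<in> {..<N}. walk_label g w t = i}"
  have sub: "walk_label g w ` {..<N} \<subseteq> I"
    using assms g by (auto simp: walk_label_def edge_labelling_def closed_walks_def walks_def subset_iff)
  have "(\<Prod>t<N. centred_adj p g \<beta> (w ! t) (w ! Suc t)) = (\<Prod>i\<in>I. (of_bool (\<beta> i) - p) ^ ?m i)" for \<beta>
  proof -
    have "(\<Prod>t<N. centred_adj p g \<beta> (w ! t) (w ! Suc t)) = (\<Prod>t<N. of_bool (\<beta> (walk_label g w t)) - p)"
      using assms(2) by (intro prod.cong) (auto simp: centred_adj_def walk_label_def)
    also have "\<dots> = (\<Prod>i\<in>I. \<Prod>t | t \<in> {..<N} \<and> walk_label g w t = i. of_bool (\<beta> (walk_label g w t)) - p)"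
      using prod.group[OF _ I sub, of "\<lambda>t. of_bool (\<beta> (walk_label g w t)) - p"] by simp
    also have "\<dots> = (\<Prod>i\<in>I. (of_bool (\<beta> i) - p) ^ ?m i)"
      by (intro prod.cong) auto
    finally show ?thesis .
  qed
  hence "measure_pmf.expectation (coins I p) (\<lambda>\<beta>. \<Prod>t<N. centred_adj p g \<beta> (w ! t) (w ! Suc t))
      = (\<Prod>i\<in>I. measure_pmf.expectation (bernoulli_pmf p) (\<lambda>b. (of_bool b - p) ^ ?m i))"
    using expectation_prod_Pi_pmf_finite[OF I, of "\<lambda>_. bernoulli_pmf p" False "\<lambda>i b. (of_bool b - p) ^ ?m i"]
    by simp
  also have "\<dots> = (\<Prod>i\<in>I. central_moment p (?m i))"
    using p by (simp add: central_moment_def mult.commute)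
  also have "\<dots> = (\<Prod>i\<in>walk_label g w ` {..<N}. central_moment p (?m i))"
  proof (rule prod.mono_neutral_right[OF I sub], rule ballI)
    fix i assume "i \<in> I - walk_label g w ` {..<N}"
    hence "{t \<in> {..<N}. walk_label g w t = i} = {}" by auto
    thus "central_moment p (?m i) = 1" by (simp only: card.empty central_moment_0)
  qed
  finally show ?thesis .
qed

lemma closed_walk_label_eq_iff:
  assumes "w \<in> closed_walks V N" "\<And>t. t < N \<Longrightarrow> w ! t \<noteq> w ! Suc t" "s < N" "t < N"
  shows "walk_label g w s = walk_label g w t \<longleftrightarrow> {w ! s, w ! Suc s} = {w ! t, w ! Suc t}"
proof -
  have "w ! s \<in> V" "w ! t \<in> V" "w ! Suc s \<in> V" "w ! Suc t \<in> V"
    using assms(1,3,4) by (auto simp: closed_walks_def walks_def subset_iff)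
  thus ?thesis unfolding walk_label_def using assms(2-4) by (intro edge_labelling_eq_iff[OF g]) auto
qed

lemma good_walk_multiplicity:
  assumes "w \<in> good_walks V N" "i \<in> walk_label g w ` {..<N}"
  shows "card {t \<in> {..<N}. walk_label g w t = i} \<ge> 2"
proof -
  from assms(2) obtain t where t: "t < N" "i = walk_label g w t" by auto
  have cw: "w \<in> closed_walks V N" "\<And>t. t < N \<Longrightarrow> w ! t \<noteq> w ! Suc t"
    using assms(1) by (auto simp: good_walks_def)
  obtain s where s: "s < N" "s \<noteq> t" "{w ! s, w ! Suc s} = {w ! t, w ! Suc t}"
    using assms(1) t(1) unfolding good_walks_def by blast
  hence "walk_label g w s = i" using closed_walk_label_eq_iff[OF cw, of s t] t by simp
  hence "{s, t} \<subseteq> {t \<in> {..<N}. walk_label g w t = i}" using s t by auto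
  hence "card {s, t} \<le> card {t \<in> {..<N}. walk_label g w t = i}" by (intro card_mono) auto
  thus ?thesis using s by simp
qed

text \<open>Either a loop makes the product vanish identically, or some coin has exponent exactly 1
  and its factor is the first central moment.\<close>

lemma not_good_walk_expectation:
  assumes "w \<in> closed_walks V N" "w \<notin> good_walks V N"
  shows "measure_pmf.expectation (coins I p) (\<lambda>\<beta>. \<Prod>t<N. centred_adj p g \<beta> (w ! t) (w ! Suc t)) = 0"
proof (cases "\<exists>t<N. w ! t = w ! Suc t")
  case True
  hence eq: "(\<lambda>\<beta>. \<Prod>t<N. centred_adj p g \<beta> (w ! t) (w ! Suc t)) = (\<lambda>_. 0)"
    by (intro ext prod_zero) (auto simp: centred_adj_def)
  show ?thesis unfolding eq by simp
next
  case False
  hence nl: "\<And>t. t < N \<Longrightarrow> w ! t \<noteq> w ! Suc t" by blast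
  define e where "e s = {w ! s, w ! Suc s}" for s
  have "\<not> (\<forall>t<N. \<exists>s<N. s \<noteq> t \<and> e s = e t)"
    using assms nl by (simp add: good_walks_def e_def)
  then obtain t where t: "t < N" "\<And>s. s < N \<Longrightarrow> s \<noteq> t \<Longrightarrow> e s \<noteq> e t" by blast
  have "walk_label g w s = walk_label g w t \<longleftrightarrow> e s = e t" if "s < N" for s
    unfolding e_def using that t(1) by (intro closed_walk_label_eq_iff assms nl)
  hence "{s \<in> {..<N}. walk_label g w s = walk_label g w t} = {t}"
    using t by blast
  hence "central_moment p (card {s \<in> {..<N}. walk_label g w s = walk_label g w t}) = 0" by simp
  hence "(\<Prod>i\<in>walk_label g w ` {..<N}. central_moment p (card {s \<in> {..<N}. walk_label g w s = i})) = 0"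
    using t(1) by (intro prod_zero) auto
  thus ?thesis using expectation_walk[OF assms(1) nl] by simp
qed

lemma expectation_trace:
  "measure_pmf.expectation (coins I p) (\<lambda>\<beta>. trace_on V (mpow V (centred_adj p g \<beta>) N)) =
    (\<Sum>w\<in>good_walks V N. \<Prod>i\<in>walk_label g w ` {..<N}. central_moment p (card {t \<in> {..<N}. walk_label g w t = i}))"
proof -
  let ?E = "\<lambda>w. measure_pmf.expectation (coins I p) (\<lambda>\<beta>. \<Prod>t<N. centred_adj p g \<beta> (w ! t) (w ! Suc t))"
  have "measure_pmf.expectation (coins I p) (\<lambda>\<beta>. trace_on V (mpow V (centred_adj p g \<beta>) N)) =
      (\<Sum>w\<in>closed_walks V N. ?E w)"
    unfolding trace_mpow_eq_sum_closed_walks[OF V]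
    by (intro Bochner_Integration.integral_sum integrable_measure_pmf_finite finite_set_coins I)
  also have "\<dots> = (\<Sum>w\<in>good_walks V N. ?E w)"
    using not_good_walk_expectation finite_closed_walks[OF V]
    by (intro sum.mono_neutral_right) (auto simp: good_walks_def)
  also have "\<dots> = (\<Sum>w\<in>good_walks V N. \<Prod>i\<in>walk_label g w ` {..<N}.
      central_moment p (card {t \<in> {..<N}. walk_label g w t = i}))"
    by (intro sum.cong refl expectation_walk) (auto simp: good_walks_def)
  finally show ?thesis .
qed

text \<open>Every distinct edge costs a factor at most \<open>p * (1 - p)\<close>. Since this is at
  most 1 and there are at least \<open>card (set w) - 1\<close> edges, the exponent may be lowered
  to a function of the vertices alone.\<close>

lemma expectation_trace_le:
  "measure_pmf.expectation (coins I p) (\<lambda>\<beta>. trace_on V (mpow V (centred_adj p g \<beta>) N)) \<le>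
    (\<Sum>w\<in>good_walks V N. (p * (1 - p)) ^ (card (set w) - 1))"
  unfolding expectation_trace
proof (rule sum_mono)
  fix w assume w: "w \<in> good_walks V N"
  let ?L = "walk_label g w ` {..<N}"
  have cw: "w \<in> closed_walks V N" "\<And>t. t < N \<Longrightarrow> w ! t \<noteq> w ! Suc t"
    using w by (auto simp: good_walks_def)
  have pq: "0 \<le> p * (1 - p)" "p * (1 - p) \<le> 1"
    using p by (auto simp: mult_le_one)
  have "(\<Prod>i\<in>?L. central_moment p (card {t \<in> {..<N}. walk_label g w t = i}))
      \<le> \<bar>\<Prod>i\<in>?L. central_moment p (card {t \<in> {..<N}. walk_label g w t = i})\<bar>" by simp
  also have "\<dots> \<le> (\<Prod>i\<in>?L. p * (1 - p))"
    unfolding abs_prod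
    using central_moment_bound[OF p good_walk_multiplicity[OF w]] by (intro prod_mono) auto
  also have "\<dots> = (p * (1 - p)) ^ card ?L" by simp
  also have "card ?L = card ((\<lambda>t. {w ! t, w ! Suc t}) ` {..<N})"
  proof (rule bij_betw_same_card)
    \<comment> \<open>Labels and undirected edges of the walk correspond bijectively;
      \<open>?f\<close> sends a label to the edge of any step that carries it.\<close>
    let ?f = "\<lambda>i. SOME e. \<exists>t<N. i = walk_label g w t \<and> e = {w ! t, w ! Suc t}"
    have f: "?f (walk_label g w t) = {w ! t, w ! Suc t}" if "t < N" for t
      using closed_walk_label_eq_iff[OF cw _ that] that
      by (intro some_equality) (metis (no_types, lifting))+
    show "bij_betw ?f ?L ((\<lambda>t. {w ! t, w ! Suc t}) ` {..<N})"
      unfolding bij_betw_def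
    proof
      show "inj_on ?f ?L"
        using closed_walk_label_eq_iff[OF cw] f by (auto simp: inj_on_def)
      show "?f ` ?L = (\<lambda>t. {w ! t, w ! Suc t}) ` {..<N}"
        unfolding image_image using f by (intro image_cong) auto
    qed
  qed
  also have "(p * (1 - p)) ^ \<dots> \<le> (p * (1 - p)) ^ (card (set w) - 1)"
    using card_vertices_le_edges[of w N] cw(1) pq
    by (intro power_decreasing) (auto simp: closed_walks_def walks_def)
  finally show "(\<Prod>i\<in>?L. central_moment p (card {t \<in> {..<N}. walk_label g w t = i}))
      \<le> (p * (1 - p)) ^ (card (set w) - 1)" .
qed

end

text \<open>The converse use of the trace expansion: at bias 1/3, after scaling by 3, every good
  walk contributes at least 1.\<close>

lemma card_good_walks_le_expectation:
  assumes V: "finite V" and I: "finite I" and g: "edge_labelling V I g"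
  shows "real (card (good_walks V N)) \<le>
    3 ^ N * measure_pmf.expectation (coins I (1/3)) (\<lambda>\<beta>. trace_on V (mpow V (centred_adj (1/3) g \<beta>) N))"
proof -
  have p: "(0::real) \<le> 1/3" "(1/3::real) \<le> 1" by auto
  have "1 \<le> 3 ^ N * (\<Prod>i\<in>walk_label g w ` {..<N}. central_moment (1/3) (card {t \<in> {..<N}. walk_label g w t = i}))"
    if w: "w \<in> good_walks V N" for w
  proof -
    let ?L = "walk_label g w ` {..<N}" and ?m = "\<lambda>i. card {t \<in> {..<N}. walk_label g w t = i}"
    \<comment> \<open>The multiplicities of the edges add up to \<open>N\<close>, so
      \<open>3 ^ N\<close> splits into one factor \<open>3 ^ ?m i\<close> per edge, as
      \<open>central_moment_third\<close> requires.\<close>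
    have "N = (\<Sum>i\<in>?L. ?m i)"
      using sum.image_gen[of "{..<N}" "\<lambda>_. 1 :: nat" "walk_label g w"] by simp
    hence "(3::real) ^ N = (\<Prod>i\<in>?L. 3 ^ ?m i)" by (metis power_sum)
    hence "3 ^ N * (\<Prod>i\<in>?L. central_moment (1/3) (?m i)) = (\<Prod>i\<in>?L. 3 ^ ?m i * central_moment (1/3) (?m i))"
      by (simp only: prod.distrib)
    also have "\<dots> \<ge> 1"
      using central_moment_third[OF good_walk_multiplicity[OF V I g p w]] by (intro prod_ge_1) auto
    finally show ?thesis .
  qed
  hence "(\<Sum>w\<in>good_walks V N. 1) \<le> (\<Sum>w\<in>good_walks V N.
      3 ^ N * (\<Prod>i\<in>walk_label g w ` {..<N}. central_moment (1/3) (card {t \<in> {..<N}. walk_label g w t = i})))"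
    by (intro sum_mono)
  thus ?thesis unfolding expectation_trace[OF V I g p] by (simp add: sum_distrib_left)
qed

section \<open>A net for the operator norm\<close>

text \<open>The integer points of the ball of radius 4 sqrt(r), with r = \<open>card U\<close>.
  Divided by this radius they form a 1/4-net of the unit ball. Extensionality (\<open>PiE\<close>)
  makes the set finite.\<close>

definition lattice_points :: "'a set \<Rightarrow> ('a \<Rightarrow> int) set" where
  "lattice_points U = {z \<in> U \<rightarrow>\<^sub>E UNIV. (\<Sum>i\<in>U. (z i)\<^sup>2) \<le> 16 * int (card U)}"

lemma abs_le_square_int: "\<bar>a\<bar> \<le> a\<^sup>2" for a :: int
proof (cases "a = 0")
  case False
  hence "\<bar>a\<bar> * 1 \<le> \<bar>a\<bar> * \<bar>a\<bar>" by (intro mult_left_mono) auto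
  thus ?thesis by (simp add: power2_eq_square)
qed simp

lemma lattice_subset:
  assumes "finite U"
  shows "lattice_points U \<subseteq> U \<rightarrow>\<^sub>E {- 16 * int (card U) .. 16 * int (card U)}"
proof (rule subsetI)
  fix z assume z: "z \<in> lattice_points U"
  show "z \<in> U \<rightarrow>\<^sub>E {- 16 * int (card U) .. 16 * int (card U)}"
  proof (rule PiE_I)
    fix i assume "i \<in> U"
    hence "(z i)\<^sup>2 \<le> (\<Sum>i\<in>U. (z i)\<^sup>2)" using assms by (intro member_le_sum) auto
    hence "\<bar>z i\<bar> \<le> 16 * int (card U)"
      using z abs_le_square_int[of "z i"] by (simp add: lattice_points_def)
    thus "z i \<in> {- 16 * int (card U) .. 16 * int (card U)}" by auto
  qed (use z in \<open>auto simp: lattice_points_def\<close>)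
qed

lemma finite_lattice: "finite U \<Longrightarrow> finite (lattice_points U)"
  by (rule finite_subset[OF lattice_subset]) (auto intro!: finite_PiE)

lemma sum_half_powers: "(\<Sum>a = - int M..int M. (1 / 2 :: real) ^ nat \<bar>a\<bar>) = 3 - 2 * (1 / 2) ^ M"
proof (induction M)
  case (Suc M)
  have "{- int (Suc M)..int (Suc M)} = insert (int (Suc M)) (insert (- int (Suc M)) {- int M..int M})"
    by auto
  thus ?case using Suc.IH by (simp add: nat_add_distrib)
qed simp

text \<open>On the lattice sum |z i| <= sum (z i)^2 <= 16 r, so the product of the weights 2^16 *
  2^(-|z i|) is at least 1. Its sum over a whole box factorises, and in each coordinate the
  geometric sum is below 3.\<close>

lemma card_lattice_le:
  assumes "finite U"
  shows "real (card (lattice_points U)) \<le> (3 * 2 ^ 16) ^ card U"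
proof -
  let ?r = "card U" and ?f = "\<lambda>a :: int. (2 ^ 16 :: real) * (1 / 2) ^ nat \<bar>a\<bar>"
  let ?B = "{- int (16 * card U) .. int (16 * card U)}"
  have sub: "lattice_points U \<subseteq> U \<rightarrow>\<^sub>E ?B" using lattice_subset[OF assms] by simp
  have "1 \<le> (\<Prod>i\<in>U. ?f (z i))" if z: "z \<in> lattice_points U" for z
  proof -
    have "int (\<Sum>i\<in>U. nat \<bar>z i\<bar>) = (\<Sum>i\<in>U. \<bar>z i\<bar>)" by simp
    also have "\<dots> \<le> (\<Sum>i\<in>U. (z i)\<^sup>2)" by (intro sum_mono abs_le_square_int)
    also have "\<dots> \<le> int (16 * ?r)" using z by (simp add: lattice_points_def)
    finally have le: "(\<Sum>i\<in>U. nat \<bar>z i\<bar>) \<le> 16 * ?r" by linarith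
    have "(1 :: real) = 2 ^ (16 * ?r) * (1 / 2) ^ (16 * ?r)" by (simp flip: power_mult_distrib)
    also have "\<dots> \<le> 2 ^ (16 * ?r) * (1 / 2) ^ (\<Sum>i\<in>U. nat \<bar>z i\<bar>)"
      using le by (intro mult_left_mono power_decreasing) auto
    also have "\<dots> = (\<Prod>i\<in>U. ?f (z i))"
      by (simp add: prod.distrib power_sum power_mult)
    finally show ?thesis .
  qed
  hence "real (card (lattice_points U)) \<le> (\<Sum>z\<in>lattice_points U. \<Prod>i\<in>U. ?f (z i))"
    using sum_mono[of "lattice_points U" "\<lambda>_. 1 :: real" "\<lambda>z. \<Prod>i\<in>U. ?f (z i)"] by simp
  also have "\<dots> \<le> (\<Sum>z\<in>U \<rightarrow>\<^sub>E ?B. \<Prod>i\<in>U. ?f (z i))"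
    using assms by (intro sum_mono2 sub prod_nonneg finite_PiE) auto
  also have "\<dots> = (\<Prod>i\<in>U. \<Sum>a\<in>?B. ?f a)"
    by (subst prod_sum_PiE) (use assms in auto)
  also have "\<dots> = (2 ^ 16 * (3 - 2 * (1 / 2) ^ (16 * ?r))) ^ ?r"
    unfolding sum_distrib_left[symmetric] sum_half_powers by simp
  also have "\<dots> \<le> (3 * 2 ^ 16) ^ ?r"
  proof (rule power_mono)
    have "(1 / 2 :: real) ^ (16 * ?r) \<le> 1" by (intro power_le_one) auto
    thus "0 \<le> 2 ^ 16 * (3 - 2 * (1 / 2 :: real) ^ (16 * ?r))" by simp
  qed simp
  finally show ?thesis .
qed

text \<open>Each coordinate moves by at most 1 / (4 sqrt(r)), so the total error in the Euclidean
  norm is at most 1/4.\<close>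

lemma lattice_round:
  assumes "finite U" "U \<noteq> {}" "L2_set f U \<le> 1"
  obtains z where "z \<in> lattice_points U" "L2_set (\<lambda>i. real_of_int (z i) / (4 * sqrt (card U))) U \<le> 1"
    "L2_set (\<lambda>i. f i - real_of_int (z i) / (4 * sqrt (card U))) U \<le> 1 / 4"
proof -
  define \<rho> where "\<rho> = 4 * sqrt (card U)"
  have \<rho>: "\<rho> > 0" "\<rho>\<^sup>2 = 16 * card U"
    using assms(1,2) by (auto simp: \<rho>_def card_gt_0_iff power_mult_distrib)
  \<comment> \<open>Rounding is towards zero: no coordinate grows in absolute value, so the rounded
    vector stays in the unit ball and hence in the net.\<close>
  define z where "z = (\<lambda>i\<in>U. if f i \<ge> 0 then \<lfloor>\<rho> * f i\<rfloor> else - \<lfloor>\<rho> * (- f i)\<rfloor>)"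
  have z: "\<bar>real_of_int (z i)\<bar> \<le> \<rho> * \<bar>f i\<bar>" "\<bar>\<rho> * f i - z i\<bar> \<le> 1" if "i \<in> U" for i
  proof -
    have "\<bar>real_of_int (z i)\<bar> \<le> \<rho> * \<bar>f i\<bar> \<and> \<bar>\<rho> * f i - z i\<bar> \<le> 1"
    proof (cases "f i \<ge> 0")
      case True
      define a where "a = \<rho> * f i"
      have "0 \<le> a" using True \<rho>(1) by (simp add: a_def)
      hence fl: "0 \<le> real_of_int \<lfloor>a\<rfloor>" "real_of_int \<lfloor>a\<rfloor> \<le> a" "a \<le> real_of_int \<lfloor>a\<rfloor> + 1"
        using floor_correct[of a] by auto
      have eq: "z i = \<lfloor>a\<rfloor>" "\<rho> * f i = a" "\<rho> * \<bar>f i\<bar> = a"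
        using True that by (auto simp: z_def a_def)
      show ?thesis unfolding eq of_int_minus using fl by linarith
    next
      case False
      define a where "a = \<rho> * (- f i)"
      have "0 \<le> a" using False \<rho>(1) by (simp add: a_def mult_nonneg_nonpos)
      hence fl: "0 \<le> real_of_int \<lfloor>a\<rfloor>" "real_of_int \<lfloor>a\<rfloor> \<le> a" "a \<le> real_of_int \<lfloor>a\<rfloor> + 1"
        using floor_correct[of a] by auto
      have eq: "z i = - \<lfloor>a\<rfloor>" "\<rho> * f i = - a" "\<rho> * \<bar>f i\<bar> = a"
        using False that by (auto simp: z_def a_def)
      show ?thesis unfolding eq of_int_minus using fl by linarith
    qed
    thus "\<bar>real_of_int (z i)\<bar> \<le> \<rho> * \<bar>f i\<bar>" "\<bar>\<rho> * f i - z i\<bar> \<le> 1" by auto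
  qed
  let ?u = "\<lambda>i. real_of_int (z i) / \<rho>"
  have u: "\<bar>?u i\<bar> \<le> \<bar>f i\<bar>" "\<bar>f i - ?u i\<bar> \<le> 1 / \<rho>" if "i \<in> U" for i
  proof -
    show "\<bar>?u i\<bar> \<le> \<bar>f i\<bar>" using z(1)[OF that] \<rho>(1) by (simp add: field_simps abs_divide)
    have "f i - ?u i = (\<rho> * f i - z i) / \<rho>" using \<rho>(1) by (simp add: field_simps)
    thus "\<bar>f i - ?u i\<bar> \<le> 1 / \<rho>" using z(2)[OF that] \<rho>(1) by (simp add: divide_right_mono)
  qed
  have "L2_set ?u U \<le> L2_set f U"
    unfolding L2_set_def using u(1) by (intro real_sqrt_le_mono sum_mono) (use abs_le_square_iff in blast)
  hence 1: "L2_set ?u U \<le> 1" using assms(3) by simp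
  have "(\<Sum>i\<in>U. (?u i)\<^sup>2) \<le> 1"
    using 1 unfolding L2_set_def by simp
  hence "(\<Sum>i\<in>U. (real_of_int (z i))\<^sup>2) \<le> \<rho>\<^sup>2"
    using \<rho>(1) by (simp add: power_divide divide_le_eq flip: sum_divide_distrib)
  hence "real_of_int (\<Sum>i\<in>U. (z i)\<^sup>2) \<le> real_of_int (16 * int (card U))"
    using \<rho>(2) by simp
  hence 2: "z \<in> lattice_points U" unfolding of_int_le_iff by (simp add: lattice_points_def z_def)
  have "(\<Sum>i\<in>U. (f i - ?u i)\<^sup>2) \<le> (\<Sum>i\<in>U. (1 / \<rho>)\<^sup>2)"
  proof (rule sum_mono)
    fix i assume "i \<in> U"
    thus "(f i - ?u i)\<^sup>2 \<le> (1 / \<rho>)\<^sup>2"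
      using power_mono[OF u(2), of i 2] by simp
  qed
  also have "\<dots> = (1 / 4)\<^sup>2" using \<rho>(2) assms(1,2) by (simp add: power_divide)
  finally have "L2_set (\<lambda>i. f i - ?u i) U \<le> 1 / 4"
    unfolding L2_set_def using real_sqrt_le_mono by fastforce
  with 1 2 that show ?thesis unfolding \<rho>_def by blast
qed

lemma bilin_scale: "bilin U A (\<lambda>x. a * f x) (\<lambda>x. b * g x) = a * b * bilin U A f g"
  by (simp add: bilin_def sum_distrib_left mult_ac)

lemma bilin_add_left: "bilin U A (\<lambda>x. f x + f' x) g = bilin U A f g + bilin U A f' g"
  by (simp add: bilin_def sum.distrib algebra_simps)

lemma bilin_add_right: "bilin U A f (\<lambda>x. g x + g' x) = bilin U A f g + bilin U A f g'"
  by (simp add: bilin_def sum.distrib algebra_simps)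

text \<open>With \<open>B\<close> the supremum over unit vectors, replacing both arguments by net
  points costs B/4 each, so B <= K + B/2. The supremum is first shown to be finite, so that B/2 can
  be absorbed.\<close>

lemma bilin_le_of_lattice:
  fixes K :: real
  assumes U: "finite U" "U \<noteq> {}"
    and K: "\<And>z z'. z \<in> lattice_points U \<Longrightarrow> z' \<in> lattice_points U \<Longrightarrow>
      bilin U A (\<lambda>i. real_of_int (z i)) (\<lambda>i. real_of_int (z' i)) \<le> 16 * real (card U) * K"
  shows "bilin U A f g \<le> 2 * K * (L2_set f U * L2_set g U)"
proof -
  define S where "S = {bilin U A f g | f g. L2_set f U \<le> 1 \<and> L2_set g U \<le> 1}"
  define B where "B = Sup S"
  have ent: "\<bar>f x\<bar> \<le> L2_set f U" if "x \<in> U" for x and f :: "'a \<Rightarrow> real"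
    using that U(1) unfolding L2_set_def
    by (metis (no_types, lifting) member_le_sum real_sqrt_abs real_sqrt_le_iff zero_le_power2)
  have bdd: "bdd_above S"
  proof (rule bdd_aboveI)
    fix s assume "s \<in> S"
    then obtain f g where s: "s = bilin U A f g" "L2_set f U \<le> 1" "L2_set g U \<le> 1"
      by (auto simp: S_def)
    have "f x * A x y * g y \<le> \<bar>A x y\<bar>" if "x \<in> U" "y \<in> U" for x y
    proof -
      have "\<bar>f x\<bar> * \<bar>g y\<bar> \<le> 1 * 1"
        using ent[OF that(1), of f] ent[OF that(2), of g] s by (intro mult_mono) auto
      hence "\<bar>A x y\<bar> * (\<bar>f x\<bar> * \<bar>g y\<bar>) \<le> \<bar>A x y\<bar>" by (simp add: mult_left_le)
      moreover have "f x * A x y * g y \<le> \<bar>f x * A x y * g y\<bar>" by simp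
      ultimately show ?thesis by (simp add: abs_mult mult_ac)
    qed
    thus "s \<le> (\<Sum>x\<in>U. \<Sum>y\<in>U. \<bar>A x y\<bar>)"
      unfolding s bilin_def by (intro sum_mono) auto
  qed
  have B: "bilin U A f g \<le> B" if "L2_set f U \<le> 1" "L2_set g U \<le> 1" for f g
    unfolding B_def using bdd that by (intro cSup_upper) (auto simp: S_def)
  have "bilin U A (\<lambda>_. 0) (\<lambda>_. 0) \<le> B" by (rule B) (auto simp: L2_set_def)
  hence B0: "B \<ge> 0" by (simp add: bilin_def)
  have hom: "bilin U A f g \<le> B * (L2_set f U * L2_set g U)" for f g
  proof (cases "L2_set f U = 0 \<or> L2_set g U = 0")
    case True
    hence "(\<forall>x\<in>U. f x = 0) \<or> (\<forall>x\<in>U. g x = 0)" using U(1) by (simp add: L2_set_eq_0_iff)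
    hence "bilin U A f g = 0" by (auto simp: bilin_def)
    thus ?thesis using True by auto
  next
    case False
    hence pos: "L2_set f U > 0" "L2_set g U > 0" using L2_set_nonneg[of f U] L2_set_nonneg[of g U] by (simp_all add: less_le)
    have unit: "L2_set (\<lambda>x. 1 / L2_set h U * h x) U = 1" if "L2_set h U > 0" for h :: "'a \<Rightarrow> real"
      using that by (subst L2_set_right_distrib[symmetric]) auto
    have "1 / L2_set f U * (1 / L2_set g U) * bilin U A f g \<le> B"
      unfolding bilin_scale[symmetric] using unit pos by (intro B) auto
    thus ?thesis using pos by (simp add: field_simps)
  qed
  let ?\<rho> = "4 * sqrt (card U)"
  have \<rho>: "?\<rho> > 0" "?\<rho> * ?\<rho> = 16 * card U" using U by (auto simp: card_gt_0_iff)
  have "bilin U A f g \<le> K + B / 2" if fg: "L2_set f U \<le> 1" "L2_set g U \<le> 1" for f g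
  proof -
    obtain z where z: "z \<in> lattice_points U" "L2_set (\<lambda>i. real_of_int (z i) / ?\<rho>) U \<le> 1"
        "L2_set (\<lambda>i. f i - real_of_int (z i) / ?\<rho>) U \<le> 1 / 4"
      using lattice_round[OF U fg(1)] by blast
    obtain z' where z': "z' \<in> lattice_points U" "L2_set (\<lambda>i. real_of_int (z' i) / ?\<rho>) U \<le> 1"
        "L2_set (\<lambda>i. g i - real_of_int (z' i) / ?\<rho>) U \<le> 1 / 4"
      using lattice_round[OF U fg(2)] by blast
    let ?u = "\<lambda>i. real_of_int (z i) / ?\<rho>" and ?v = "\<lambda>i. real_of_int (z' i) / ?\<rho>"
    have "bilin U A f g = bilin U A (\<lambda>i. ?u i + (f i - ?u i)) g" by simp
    also have "\<dots> = bilin U A ?u (\<lambda>i. ?v i + (g i - ?v i)) + bilin U A (\<lambda>i. f i - ?u i) g"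
      by (subst bilin_add_left) simp
    also have "\<dots> = bilin U A ?u ?v + bilin U A ?u (\<lambda>i. g i - ?v i) + bilin U A (\<lambda>i. f i - ?u i) g"
      by (subst bilin_add_right) simp
    finally have split: "bilin U A f g
        = bilin U A ?u ?v + bilin U A ?u (\<lambda>i. g i - ?v i) + bilin U A (\<lambda>i. f i - ?u i) g" .
    have "bilin U A ?u ?v = 1 / ?\<rho> * (1 / ?\<rho>) * bilin U A (\<lambda>i. real_of_int (z i)) (\<lambda>i. real_of_int (z' i))"
      unfolding bilin_scale[symmetric] by simp
    also have "\<dots> = bilin U A (\<lambda>i. real_of_int (z i)) (\<lambda>i. real_of_int (z' i)) / (?\<rho> * ?\<rho>)"
      by simp
    also have "\<dots> \<le> 16 * real (card U) * K / (?\<rho> * ?\<rho>)"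
      using K[OF z(1) z'(1)] \<rho> by (intro divide_right_mono) auto
    also have "\<dots> = K" using \<rho> U by (simp add: \<rho>(2))
    finally have 1: "bilin U A ?u ?v \<le> K" .
    have le: "bilin U A h h' \<le> B / 4" if "L2_set h U * L2_set h' U \<le> 1 / 4" for h h'
      using hom[of h h'] mult_left_mono[OF that B0] by simp
    have 2: "bilin U A ?u (\<lambda>i. g i - ?v i) \<le> B / 4"
      using mult_mono[OF z(2) z'(3)] by (intro le) (simp add: L2_set_nonneg)
    have 3: "bilin U A (\<lambda>i. f i - ?u i) g \<le> B / 4"
      using mult_mono[OF z(3) fg(2)] by (intro le) (simp add: L2_set_nonneg)
    show ?thesis using split 1 2 3 by simp
  qed
  hence "B \<le> K + B / 2"
    unfolding B_def by (intro cSup_least) (auto simp: S_def intro!: exI[of _ "\<lambda>_. 0"] simp: L2_set_def B_def)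
  hence "B \<le> 2 * K" by simp
  hence "B * (L2_set f U * L2_set g U) \<le> 2 * K * (L2_set f U * L2_set g U)"
    by (intro mult_right_mono) (auto simp: L2_set_nonneg)
  thus ?thesis using hom[of f g] by simp
qed

section \<open>The dense model and the norm bound\<close>

text \<open>For a variable of mean zero the linear term drops out in expectation, leaving E exp(X)
  <= E exp(X^2). This is the source of the sub-Gaussian bound.\<close>

lemma exp_le_self_plus_exp_square: "exp x \<le> x + exp (x\<^sup>2)" for x :: real
proof -
  consider "x \<ge> 1" | "0 \<le> x" "x \<le> 1" | "- 1 \<le> x" "x \<le> 0" | "x \<le> - 1" by linarith
  thus ?thesis
  proof cases
    case 1
    hence "x * 1 \<le> x * x" by (intro mult_left_mono) auto
    hence "exp x \<le> exp (x\<^sup>2)" by (simp add: power2_eq_square)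
    thus ?thesis using 1 by linarith
  next
    case 2
    hence "exp x \<le> 1 + x + x\<^sup>2" by (rule exp_bound)
    thus ?thesis using exp_ge_add_one_self[of "x\<^sup>2"] by linarith
  next
    case 3
    have "exp (- x) \<ge> 1 - x + x\<^sup>2 / 2"
      using exp_lower_Taylor_quadratic[of "- x"] 3 by simp
    have pos: "1 + x + x\<^sup>2 > 0"
      using 3 by (sos)
    have "(1 + x + x\<^sup>2) * exp (- x) \<ge> (1 + x + x\<^sup>2) * (1 - x + x\<^sup>2 / 2)"
      using pos \<open>exp (- x) \<ge> 1 - x + x\<^sup>2 / 2\<close> by (intro mult_left_mono) auto
    also have "(1 + x + x\<^sup>2) * (1 - x + x\<^sup>2 / 2) = 1 + x\<^sup>2 / 2 * (1 - x + x\<^sup>2)"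
      by (simp add: power2_eq_square field_simps)
    finally have "1 \<le> (1 + x + x\<^sup>2) * exp (- x)"
      using 3 by (smt (verit) mult_nonneg_nonneg zero_le_power2 divide_nonneg_nonneg)
    hence "exp x \<le> 1 + x + x\<^sup>2" by (simp add: exp_minus field_simps)
    thus ?thesis using exp_ge_add_one_self[of "x\<^sup>2"] by linarith
  next
    case 4
    hence "0 \<le> (- x) * (- x - 1)" by (intro mult_nonneg_nonneg) auto
    hence "1 \<le> x + (1 + x\<^sup>2)" by (simp add: power2_eq_square algebra_simps)
    moreover have "exp x \<le> 1" using 4 by simp
    ultimately show ?thesis using exp_ge_add_one_self[of "x\<^sup>2"] by linarith
  qed
qed

lemma power_le_fact_exp:
  assumes "x \<ge> (0 :: real)"
  shows "x ^ N \<le> fact N * exp x"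
proof -
  have "(\<Sum>n\<in>{N}. x ^ n /\<^sub>R fact n) \<le> (\<Sum>n. x ^ n /\<^sub>R fact n)"
    using assms by (intro sum_le_suminf summable_exp_generic) auto
  hence "x ^ N / fact N \<le> exp x" by (simp add: exp_def divide_inverse mult.commute)
  thus ?thesis by (simp add: field_simps)
qed

lemma exp_moment_coins:
  fixes d :: "'i \<Rightarrow> real"
  assumes "finite I"
  shows "measure_pmf.expectation (coins I (1/3)) (\<lambda>\<beta>. exp (\<Sum>i\<in>I. d i * (3 * (of_bool (\<beta> i) - 1/3))))
    \<le> exp (4 * (\<Sum>i\<in>I. (d i)\<^sup>2))"
proof -
  have "measure_pmf.expectation (coins I (1/3)) (\<lambda>\<beta>. exp (\<Sum>i\<in>I. d i * (3 * (of_bool (\<beta> i) - 1/3))))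
      = (\<Prod>i\<in>I. measure_pmf.expectation (bernoulli_pmf (1/3)) (\<lambda>b. exp (d i * (3 * (of_bool b - 1/3)))))"
    unfolding exp_sum[OF assms]
    by (rule expectation_prod_Pi_pmf_finite[OF assms]) simp
  also have "\<dots> \<le> (\<Prod>i\<in>I. exp (4 * (d i)\<^sup>2))"
  proof (rule prod_mono, rule conjI)
    fix i assume "i \<in> I"
    show "0 \<le> measure_pmf.expectation (bernoulli_pmf (1/3)) (\<lambda>b. exp (d i * (3 * (of_bool b - 1/3))))"
      by (intro integral_nonneg_AE) auto
    have "measure_pmf.expectation (bernoulli_pmf (1/3)) (\<lambda>b. exp (d i * (3 * (of_bool b - 1/3))))
        = exp (2 * d i) / 3 + 2 * exp (- d i) / 3" by (simp add: mult.commute)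
    \<comment> \<open>The linear terms 2d/3 and -2d/3 cancel because the coin is centred; the
      constant 4 comes from the larger value 2 of the scaled coin.\<close>
    also have "\<dots> \<le> (2 * d i + exp ((2 * d i)\<^sup>2)) / 3 + 2 * (- d i + exp ((- d i)\<^sup>2)) / 3"
      using exp_le_self_plus_exp_square[of "2 * d i"] exp_le_self_plus_exp_square[of "- d i"]
      by (intro add_mono divide_right_mono mult_left_mono) auto
    also have "\<dots> = exp (4 * (d i)\<^sup>2) / 3 + 2 * exp ((d i)\<^sup>2) / 3"
      by (simp add: power_mult_distrib field_simps)
    also have "\<dots> \<le> exp (4 * (d i)\<^sup>2)" 
    proof -
      have "exp ((d i)\<^sup>2) \<le> exp (4 * (d i)\<^sup>2)" by simp
      thus ?thesis by linarith
    qed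
    finally show "measure_pmf.expectation (bernoulli_pmf (1/3)) (\<lambda>b. exp (d i * (3 * (of_bool b - 1/3))))
        \<le> exp (4 * (d i)\<^sup>2)" .
  qed
  also have "\<dots> = exp (4 * (\<Sum>i\<in>I. (d i)\<^sup>2))"
    by (simp add: exp_sum[OF assms] sum_distrib_left)
  finally show ?thesis .
qed

text \<open>One term of the exponential series bounds W^N by N! s^(-N) (exp(sW) + exp(-sW)). The
  choice s = sqrt(N) balances N! <= s^(2N) against the exponential moment exp(8N).\<close>

lemma even_moment_coins:
  fixes d :: "'i \<Rightarrow> real"
  assumes I: "finite I" and N: "even N" "N \<ge> 1" and d: "(\<Sum>i\<in>I. (d i)\<^sup>2) \<le> 2"
  shows "measure_pmf.expectation (coins I (1/3)) (\<lambda>\<beta>. (\<Sum>i\<in>I. d i * (3 * (of_bool (\<beta> i) - 1/3))) ^ N)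
    \<le> 2 * (sqrt N * exp 8) ^ N"
proof -
  let ?E = "measure_pmf.expectation (coins I (1/3))"
  let ?W = "\<lambda>\<beta>. \<Sum>i\<in>I. d i * (3 * (of_bool (\<beta> i) - 1/3))"
  let ?s = "sqrt (real N)"
  have int: "integrable (coins I (1/3)) f" for f :: "_ \<Rightarrow> real"
    by (rule integrable_measure_pmf_finite[OF finite_set_coins[OF I]])
  have mgf: "?E (\<lambda>\<beta>. exp (a * ?W \<beta>)) \<le> exp (8 * N)" if "a\<^sup>2 = N" for a :: real
  proof -
    have "?E (\<lambda>\<beta>. exp (a * ?W \<beta>)) \<le> exp (4 * (\<Sum>i\<in>I. (a * d i)\<^sup>2))"
      using exp_moment_coins[OF I, of "\<lambda>i. a * d i"] by (simp add: sum_distrib_left mult.assoc)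
    also have "(\<Sum>i\<in>I. (a * d i)\<^sup>2) = N * (\<Sum>i\<in>I. (d i)\<^sup>2)"
      by (simp add: power_mult_distrib that sum_distrib_left)
    also have "exp (4 * \<dots>) \<le> exp (8 * N)"
      using mult_left_mono[OF d, of "real N"] by simp
    finally show ?thesis .
  qed
  have \<lambda>: "?s > 0" using N by simp
  have "?E (\<lambda>\<beta>. ?W \<beta> ^ N) \<le> ?E (\<lambda>\<beta>. fact N / ?s ^ N * (exp (?s * ?W \<beta>) + exp (- ?s * ?W \<beta>)))"
  proof (rule integral_mono[OF int int])
    fix \<beta>
    have "?s ^ N * ?W \<beta> ^ N = \<bar>?s * ?W \<beta>\<bar> ^ N"
      using N(1) by (simp add: power_mult_distrib abs_mult power_even_abs)
    also have "\<dots> \<le> fact N * exp \<bar>?s * ?W \<beta>\<bar>" by (rule power_le_fact_exp) simp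
    also have "exp \<bar>?s * ?W \<beta>\<bar> \<le> exp (?s * ?W \<beta>) + exp (- ?s * ?W \<beta>)"
      by (cases "?s * ?W \<beta> \<ge> 0") auto
    finally have "?s ^ N * ?W \<beta> ^ N \<le> fact N * (exp (?s * ?W \<beta>) + exp (- ?s * ?W \<beta>))" by simp
    thus "?W \<beta> ^ N \<le> fact N / ?s ^ N * (exp (?s * ?W \<beta>) + exp (- ?s * ?W \<beta>))"
      using \<lambda> by (simp add: pos_le_divide_eq mult.commute)
  qed
  also have "\<dots> = fact N / ?s ^ N * (?E (\<lambda>\<beta>. exp (?s * ?W \<beta>)) + ?E (\<lambda>\<beta>. exp (- ?s * ?W \<beta>)))"
    using int by simp
  also have "\<dots> \<le> fact N / ?s ^ N * (exp (8 * N) + exp (8 * N))"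
    using mgf[of ?s] mgf[of "- ?s"] by (intro mult_left_mono add_mono) auto
  also have "\<dots> \<le> (?s ^ N * ?s ^ N) / ?s ^ N * (exp (8 * N) + exp (8 * N))"
  proof (intro mult_right_mono divide_right_mono)
    have "(fact N :: real) \<le> real N ^ N"
      using fact_le_power[of N, where 'a = real] by simp
    thus "fact N \<le> ?s ^ N * ?s ^ N" by (simp flip: power_mult_distrib)
  qed auto
  also have "\<dots> = 2 * (?s * exp 8) ^ N"
    using \<lambda> by (simp add: power_mult_distrib exp_of_nat_mult mult.commute)
  finally show ?thesis .
qed

section \<open>The dense random matrix on N vertices\<close>

definition pairs :: "nat \<Rightarrow> (nat \<times> nat) set" where
  "pairs r = (SIGMA j:{..<r}. {..<j})"

definition pair_label :: "nat \<Rightarrow> nat \<Rightarrow> nat \<times> nat" where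
  "pair_label x y = (max x y, min x y)"

lemma finite_pairs: "finite (pairs r)"
  by (simp add: pairs_def)

lemma edge_labelling_pairs: "edge_labelling {..<r} (pairs r) pair_label"
  unfolding edge_labelling_def pair_label_def pairs_def
  by (auto simp: doubleton_eq_iff max_def min_def split: if_splits)

lemma sum_square_split:
  fixes h :: "nat \<Rightarrow> nat \<Rightarrow> real"
  shows "(\<Sum>x<r. \<Sum>y<r. h x y) = (\<Sum>x<r. h x x) + (\<Sum>(j, i)\<in>pairs r. h i j + h j i)"
proof -
  have "(\<Sum>x<r. \<Sum>y<r. h x y) = (\<Sum>x<r. h x x) + (\<Sum>j<r. \<Sum>i<j. h i j + h j i)"
    by (induction r) (simp_all add: sum.distrib)
  thus ?thesis by (simp add: pairs_def sum.Sigma)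
qed

text \<open>The form is linear in the coins, and its coefficients satisfy sum d^2 <= 2 |z|^2 |z'|^2
  / (16 N)^2 <= 2 on the lattice. Here \<open>N\<close> is both the moment order and the number of
  vertices.\<close>

lemma lattice_moment:
  assumes z: "z \<in> lattice_points {..<N}" "z' \<in> lattice_points {..<N}" and N: "even N" "N \<ge> 1"
  shows "measure_pmf.expectation (coins (pairs N) (1/3))
      (\<lambda>\<beta>. (3 * bilin {..<N} (centred_adj (1/3) pair_label \<beta>) (\<lambda>i. real_of_int (z i)) (\<lambda>i. real_of_int (z' i)) / (16 * N)) ^ N)
    \<le> 2 * (sqrt N * exp 8) ^ N"
proof -
  let ?z = "\<lambda>i. real_of_int (z i)" and ?z' = "\<lambda>i. real_of_int (z' i)"
  define d where "d = (\<lambda>(j, i). (?z i * ?z' j + ?z j * ?z' i) / (16 * N))"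
  have eq: "3 * bilin {..<N} (centred_adj (1/3) pair_label \<beta>) ?z ?z' / (16 * N)
      = (\<Sum>e\<in>pairs N. d e * (3 * (of_bool (\<beta> e) - 1/3)))" for \<beta>
  proof -
    have "bilin {..<N} (centred_adj (1/3) pair_label \<beta>) ?z ?z'
        = (\<Sum>(j, i)\<in>pairs N. (?z i * ?z' j + ?z j * ?z' i) * (of_bool (\<beta> (j, i)) - 1/3))"
      unfolding bilin_def sum_square_split
      by (auto simp: centred_adj_def pair_label_def pairs_def algebra_simps intro!: sum.cong)
    hence "3 * bilin {..<N} (centred_adj (1/3) pair_label \<beta>) ?z ?z' / (16 * N)
        = (\<Sum>e\<in>pairs N. 3 * (case e of (j, i) \<Rightarrow> (?z i * ?z' j + ?z j * ?z' i) * (of_bool (\<beta> (j, i)) - 1/3)) / (16 * N))"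
      by (simp only: sum_distrib_left sum_divide_distrib)
    also have "\<dots> = (\<Sum>e\<in>pairs N. d e * (3 * (of_bool (\<beta> e) - 1/3)))"
      unfolding d_def case_prod_unfold prod.collapse
      by (simp only: times_divide_eq_left times_divide_eq_right mult_ac)
    finally show ?thesis .
  qed
  have sq: "(\<Sum>x<N. (?z x)\<^sup>2) \<le> 16 * N" "(\<Sum>x<N. (?z' x)\<^sup>2) \<le> 16 * N"
    using z of_int_le_iff[of "\<Sum>x<N. (z x)\<^sup>2" "16 * int N", where 'a = real]
      of_int_le_iff[of "\<Sum>x<N. (z' x)\<^sup>2" "16 * int N", where 'a = real]
    by (simp_all add: lattice_points_def)
  have "(\<Sum>e\<in>pairs N. (d e)\<^sup>2) \<le> (\<Sum>(j, i)\<in>pairs N. 2 * ((?z i)\<^sup>2 * (?z' j)\<^sup>2 + (?z j)\<^sup>2 * (?z' i)\<^sup>2) / (16 * real N)\<^sup>2)"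
  proof (rule sum_mono)
    fix e assume "e \<in> pairs N"
    obtain j i where e: "e = (j, i)" by (cases e)
    have "(a + b)\<^sup>2 \<le> 2 * (a\<^sup>2 + b\<^sup>2)" for a b :: real
      using sum_squares_ge_zero[of "a - b" 0] by (simp add: power2_eq_square algebra_simps)
    from this[of "?z i * ?z' j" "?z j * ?z' i"]
    show "(d e)\<^sup>2 \<le> (case e of (j, i) \<Rightarrow> 2 * ((?z i)\<^sup>2 * (?z' j)\<^sup>2 + (?z j)\<^sup>2 * (?z' i)\<^sup>2) / (16 * real N)\<^sup>2)"
      by (simp add: e d_def power_divide power_mult_distrib divide_right_mono)
  qed
  also have "\<dots> = 2 / (16 * real N)\<^sup>2 * (\<Sum>(j, i)\<in>pairs N. (?z i)\<^sup>2 * (?z' j)\<^sup>2 + (?z j)\<^sup>2 * (?z' i)\<^sup>2)"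
    by (simp only: sum_distrib_left case_prod_unfold times_divide_eq_left)
  also have "\<dots> \<le> 2 / (16 * real N)\<^sup>2 * (\<Sum>x<N. \<Sum>y<N. (?z x)\<^sup>2 * (?z' y)\<^sup>2)"
    unfolding sum_square_split[of "\<lambda>x y. (?z x)\<^sup>2 * (?z' y)\<^sup>2"]
    by (intro mult_left_mono) (auto simp: sum_nonneg)
  also have "\<dots> = 2 / (16 * real N)\<^sup>2 * ((\<Sum>x<N. (?z x)\<^sup>2) * (\<Sum>y<N. (?z' y)\<^sup>2))"
    by (simp add: sum_product)
  also have "\<dots> \<le> 2 / (16 * real N)\<^sup>2 * ((16 * real N) * (16 * real N))"
    using sq by (intro mult_left_mono mult_mono) (auto intro: sum_nonneg)
  also have "\<dots> = 2" using N by (simp add: power2_eq_square)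
  finally have "(\<Sum>e\<in>pairs N. (d e)\<^sup>2) \<le> 2" .
  thus ?thesis unfolding eq by (intro even_moment_coins finite_pairs N)
qed

text \<open>The 8 collects three factors 2: from N <= 2^N, from the loss 2 in passing from net to
  norm, and from the moment bound. The square counts pairs of lattice points, and
  \<open>exp 8\<close> comes from \<open>even_moment_coins\<close>.\<close>

definition dense_const :: real where
  "dense_const = 8 * (3 * 2 ^ 16)\<^sup>2 * exp 8"

text \<open>
  On \<open>N\<close> vertices a union bound over the lattice only loses a factor exponential in \<open>N\<close>, which
  is harmless for the \<open>N\<close>-th moment.
\<close>
lemma dense_trace_bound:
  assumes N: "even N" "N \<ge> 1"
  shows "3 ^ N * measure_pmf.expectation (coins (pairs N) (1/3))
      (\<lambda>\<beta>. trace_on {..<N} (mpow {..<N} (centred_adj (1/3) pair_label \<beta>) N)) \<le> (dense_const * sqrt N) ^ N"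
proof -
  let ?E = "measure_pmf.expectation (coins (pairs N) (1/3))"
  let ?L = "lattice_points {..<N}"
  let ?X = "\<lambda>\<beta>. centred_adj (1/3) pair_label \<beta>"
  let ?b = "\<lambda>\<beta> z z'. bilin {..<N} (?X \<beta>) (\<lambda>i. real_of_int (z i)) (\<lambda>i. real_of_int (z' i))"
  have int: "integrable (coins (pairs N) (1/3)) f" for f :: "_ \<Rightarrow> real"
    by (rule integrable_measure_pmf_finite[OF finite_set_coins[OF finite_pairs]])
  have finL: "finite ?L" by (simp add: finite_lattice)
  have z0: "(\<lambda>i\<in>{..<N}. 0) \<in> ?L" by (simp add: lattice_points_def)
  have det: "3 ^ N * trace_on {..<N} (mpow {..<N} (?X \<beta>) N)
      \<le> N * 2 ^ N * (\<Sum>z\<in>?L. \<Sum>z'\<in>?L. (3 * ?b \<beta> z z' / (16 * N)) ^ N)" for \<beta>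
  proof -
    define S where "S = (\<lambda>(z, z'). \<bar>?b \<beta> z z'\<bar> / (16 * N)) ` (?L \<times> ?L)"
    have S: "finite S" "S \<noteq> {}" using finL z0 by (auto simp: S_def)
    define K where "K = Max S"
    have K: "\<bar>?b \<beta> z z'\<bar> / (16 * N) \<le> K" if "z \<in> ?L" "z' \<in> ?L" for z z'
      unfolding K_def using S that by (intro Max_ge) (auto simp: S_def)
    have "0 \<le> \<bar>?b \<beta> (\<lambda>i\<in>{..<N}. 0) (\<lambda>i\<in>{..<N}. 0)\<bar> / (16 * N)" by simp
    hence K0: "K \<ge> 0" using K[OF z0 z0] by linarith
    have "?b \<beta> z z' \<le> 16 * real (card {..<N}) * K" if "z \<in> ?L" "z' \<in> ?L" for z z'
      using K[OF that] N by (simp add: divide_le_eq mult.commute)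
    hence "bilin {..<N} (?X \<beta>) f g \<le> 2 * K * (L2_set f {..<N} * L2_set g {..<N})" for f g
      using N by (intro bilin_le_of_lattice) (auto simp: lessThan_empty_iff)
    hence tr: "trace_on {..<N} (mpow {..<N} (?X \<beta>) N) \<le> card {..<N} * (2 * K) ^ N"
      using K0 by (intro trace_mpow_le) auto
    \<comment> \<open>The maximum over pairs of net points is attained. As \<open>N\<close> is even,
      all \<open>N\<close>-th powers are nonnegative, so the attained one is at most the sum over
      all pairs; this is the union bound at the level of moments.\<close>
    obtain z z' where zz: "z \<in> ?L" "z' \<in> ?L" "K = \<bar>?b \<beta> z z'\<bar> / (16 * N)"
      using Max_in[OF S] unfolding K_def[symmetric] by (auto simp: S_def)
    have nn: "0 \<le> (3 * ?b \<beta> z z' / (16 * N)) ^ N" for z z' using N(1) by (simp add: zero_le_even_power)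
    have "(3 * K) ^ N = (3 * ?b \<beta> z z' / (16 * N)) ^ N"
      unfolding zz(3) using N(1) by (simp add: power_divide power_mult_distrib power_even_abs)
    also have "\<dots> \<le> (\<Sum>z'\<in>?L. (3 * ?b \<beta> z z' / (16 * N)) ^ N)"
      using finL zz(2) nn by (intro member_le_sum[of z' ?L "\<lambda>z'. (3 * ?b \<beta> z z' / (16 * N)) ^ N"]) auto
    also have "\<dots> \<le> (\<Sum>z\<in>?L. \<Sum>z'\<in>?L. (3 * ?b \<beta> z z' / (16 * N)) ^ N)"
      using finL zz(1) nn by (intro member_le_sum[of z ?L "\<lambda>z. \<Sum>z'\<in>?L. (3 * ?b \<beta> z z' / (16 * N)) ^ N"] sum_nonneg) auto
    finally have "N * 2 ^ N * (3 * K) ^ N \<le> N * 2 ^ N * (\<Sum>z\<in>?L. \<Sum>z'\<in>?L. (3 * ?b \<beta> z z' / (16 * N)) ^ N)"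
      by (intro mult_left_mono) auto
    moreover have "3 ^ N * (card {..<N} * (2 * K) ^ N) = N * 2 ^ N * (3 * K) ^ N"
      by (simp add: power_mult_distrib)
    moreover have "3 ^ N * trace_on {..<N} (mpow {..<N} (?X \<beta>) N) \<le> 3 ^ N * (card {..<N} * (2 * K) ^ N)"
      by (rule mult_left_mono[OF tr]) simp
    ultimately show ?thesis by linarith
  qed
  have "3 ^ N * ?E (\<lambda>\<beta>. trace_on {..<N} (mpow {..<N} (?X \<beta>) N))
      = ?E (\<lambda>\<beta>. 3 ^ N * trace_on {..<N} (mpow {..<N} (?X \<beta>) N))" by simp
  also have "\<dots> \<le> ?E (\<lambda>\<beta>. N * 2 ^ N * (\<Sum>z\<in>?L. \<Sum>z'\<in>?L. (3 * ?b \<beta> z z' / (16 * N)) ^ N))"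
    by (rule integral_mono[OF int int det])
  also have "\<dots> = N * 2 ^ N * (\<Sum>z\<in>?L. \<Sum>z'\<in>?L. ?E (\<lambda>\<beta>. (3 * ?b \<beta> z z' / (16 * N)) ^ N))"
    by (subst integral_mult_right_zero, subst Bochner_Integration.integral_sum[OF int])
      (intro arg_cong2[where f = "(*)"] refl sum.cong Bochner_Integration.integral_sum[OF int])
  also have "\<dots> \<le> N * 2 ^ N * (\<Sum>z\<in>?L. \<Sum>z'\<in>?L. 2 * (sqrt N * exp 8) ^ N)"
    using lattice_moment[OF _ _ N] by (intro mult_left_mono sum_mono) auto
  also have "\<dots> = N * 2 ^ N * (real (card ?L) * real (card ?L) * (2 * (sqrt N * exp 8) ^ N))"
    by simp
  also have "\<dots> \<le> 2 ^ N * 2 ^ N * ((3 * 2 ^ 16) ^ N * (3 * 2 ^ 16) ^ N * (2 ^ N * (sqrt N * exp 8) ^ N))"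
  proof -
    have 1: "real N \<le> 2 ^ N" using of_nat_less_two_power[of N, where 'a = real] by simp
    have 2: "real (card ?L) \<le> (3 * 2 ^ 16) ^ N" using card_lattice_le[of "{..<N}"] by simp
    have 3: "(2 :: real) \<le> 2 ^ N" using power_increasing[of 1 N "2 :: real"] N by simp
    show ?thesis
      by (intro mult_mono 1 2 3 order_refl mult_nonneg_nonneg zero_le_power of_nat_0_le_iff) auto
  qed
  also have "\<dots> = (dense_const * sqrt N) ^ N"
  proof -
    have "2 * 2 * (3 * 2 ^ 16 * (3 * 2 ^ 16) * (2 * (sqrt N * exp 8))) = dense_const * sqrt N"
      by (simp add: dense_const_def)
    thus ?thesis by (simp only: power_mult_distrib[symmetric])
  qed
  finally show ?thesis .
qed

text \<open>
  The number of vertices of the dense comparison model equals the length \<open>N\<close> of the walks; this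
  makes both the comparison and the dense bound lossless up to constants.
\<close>
lemma sparse_trace_bound:
  assumes V: "finite V" and I: "finite I" and g: "edge_labelling V I g" and p: "0 \<le> p" "p \<le> 1"
    and N: "even N" "N \<ge> 1" and Vp: "2 * (real (card V) * (p * (1 - p))) \<le> real N"
  shows "measure_pmf.expectation (coins I p) (\<lambda>\<beta>. trace_on V (mpow V (centred_adj p g \<beta>) N))
    \<le> real (card V) * (dense_const * sqrt N) ^ N"
proof -
  obtain l where l: "N = 2 * l" using N(1) by (elim evenE)
  have l1: "l \<ge> 1" using N(2) l by simp
  have "measure_pmf.expectation (coins I p) (\<lambda>\<beta>. trace_on V (mpow V (centred_adj p g \<beta>) N))
      \<le> (\<Sum>w\<in>good_walks V N. (p * (1 - p)) ^ (card (set w) - 1))"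
    by (rule expectation_trace_le[OF V I g p])
  \<comment> \<open>With \<open>U = {..<N}\<close> and \<open>N = 2 * l\<close> the condition
    \<open>2 * l <= card U\<close> is an equality, and the assumption \<open>Vp\<close> says
    precisely that |V| p (1 - p) <= l.\<close>
  also have "\<dots> \<le> real (card V) / real l * real (card (good_walks {..<N} N))"
    unfolding l using l1 Vp p by (intro good_walks_comparison[OF V]) (auto simp: l)
  also have "\<dots> \<le> real (card V) / real l * (dense_const * sqrt N) ^ N"
    using card_good_walks_le_expectation[OF _ finite_pairs edge_labelling_pairs, of N N]
      dense_trace_bound[OF N] by (intro mult_left_mono) auto
  also have "\<dots> \<le> real (card V) / 1 * (dense_const * sqrt N) ^ N"
    using l1 by (intro mult_right_mono divide_left_mono zero_le_power mult_nonneg_nonneg) (auto simp: dense_const_def)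
  finally show ?thesis by simp
qed

text \<open>Markov's inequality for the trace: the threshold exceeds
  \<open>dense_const * sqrt N\<close> by the factor \<open>exp 1\<close>, whose \<open>N\<close>-th
  power is the gain exp(N). The trace controls all \<open>f\<close> at once.\<close>

lemma centred_adj_norm_tail:
  assumes V: "finite V" and I: "finite I" and g: "edge_labelling V I g" and p: "0 \<le> p" "p \<le> 1"
    and N: "N = 2 ^ j" "j \<ge> 1" and Vp: "2 * (real (card V) * (p * (1 - p))) \<le> real N"
  shows "measure_pmf.prob (coins I p)
      {\<beta>. \<exists>f. \<bar>bilin V (centred_adj p g \<beta>) f f\<bar> > exp 1 * dense_const * sqrt N * (\<Sum>x\<in>V. (f x)\<^sup>2)}
    \<le> real (card V) * exp (- real N)"
proof -
  let ?X = "\<lambda>\<beta>. centred_adj p g \<beta>"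
  let ?T = "\<lambda>\<beta>. trace_on V (mpow V (?X \<beta>) N)"
  define K where "K = exp 1 * dense_const * sqrt N"
  have even: "even N" using N by simp
  have N1: "N \<ge> 1" using N by simp
  have dc: "dense_const > 0" by (simp add: dense_const_def)
  have K: "K > 0" using N1 dc by (simp add: K_def)
  have int: "integrable (coins I p) f" for f :: "_ \<Rightarrow> real"
    by (rule integrable_measure_pmf_finite[OF finite_set_coins[OF I]])
  have T0: "?T \<beta> \<ge> 0" for \<beta>
  proof -
    obtain i where i: "j = Suc i" using N(2) by (cases j) auto
    have NN: "N = 2 ^ i + 2 ^ i" using N(1) i by simp
    have "trace_on V (mpow V (?X \<beta>) (2 ^ i + 2 ^ i)) = (\<Sum>x\<in>V. \<Sum>y\<in>V. (mpow V (?X \<beta>) (2 ^ i) x y)\<^sup>2)"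
      by (rule trace_mpow_double[OF V centred_adj_sym[OF g]])
    thus ?thesis unfolding NN by (simp add: sum_nonneg)
  qed
  have "{\<beta>. \<exists>f. \<bar>bilin V (?X \<beta>) f f\<bar> > K * (\<Sum>x\<in>V. (f x)\<^sup>2)} \<subseteq> {\<beta> \<in> space (coins I p). ?T \<beta> \<ge> K ^ N}"
  proof clarify
    fix \<beta> f assume f: "\<bar>bilin V (?X \<beta>) f f\<bar> > K * (\<Sum>x\<in>V. (f x)\<^sup>2)"
    let ?s = "\<Sum>x\<in>V. (f x)\<^sup>2"
    have s: "?s \<ge> 0" by (simp add: sum_nonneg)
    have "(K * ?s) ^ N < \<bar>bilin V (?X \<beta>) f f\<bar> ^ N"
      using f K s N1 by (intro power_strict_mono) auto
    also have "\<dots> = bilin V (?X \<beta>) f f ^ N" using even by (simp add: power_even_abs)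
    also have "\<dots> \<le> ?s ^ N * ?T \<beta>"
      unfolding N(1) using centred_adj_sym[OF g] by (intro quadratic_form_power_le_trace V N(2)) auto
    finally have "?s ^ N * K ^ N < ?s ^ N * ?T \<beta>" by (simp add: power_mult_distrib mult.commute)
    hence "K ^ N < ?T \<beta>"
      using s by (simp add: mult_less_cancel_left)
    thus "\<beta> \<in> space (coins I p) \<and> ?T \<beta> \<ge> K ^ N" by simp
  qed
  hence "measure_pmf.prob (coins I p) {\<beta>. \<exists>f. \<bar>bilin V (?X \<beta>) f f\<bar> > K * (\<Sum>x\<in>V. (f x)\<^sup>2)}
      \<le> measure_pmf.prob (coins I p) {\<beta> \<in> space (coins I p). ?T \<beta> \<ge> K ^ N}"
    by (intro measure_pmf.finite_measure_mono) auto
  also have "\<dots> \<le> measure_pmf.expectation (coins I p) ?T / K ^ N"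
    using T0 K by (intro integral_Markov_inequality_measure[where A = "{}"] int) auto
  also have "\<dots> \<le> real (card V) * (dense_const * sqrt N) ^ N / K ^ N"
    using sparse_trace_bound[OF V I g p even N1 Vp] K by (intro divide_right_mono) auto
  also have "\<dots> = real (card V) * exp (- real N)"
  proof -
    have "K ^ N = exp (real N) * (dense_const * sqrt N) ^ N"
      by (simp add: K_def power_mult_distrib exp_of_nat_mult[of N 1, simplified])
    moreover have "(dense_const * sqrt N) ^ N > 0" using dc N1 by simp
    ultimately show ?thesis using dc N1 by (simp add: exp_minus field_simps)
  qed
  finally show ?thesis unfolding K_def .
qed

section \<open>Garland's localisation and the semidefinite program\<close>

text \<open>Cholesky factorisation by induction on the index set. It turns pairing a matrix with
  \<open>Y\<close> into a sum of quadratic forms, to which norm bounds apply.\<close>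

lemma gram_representation:
  assumes "finite I" "sym_psd_on I Y"
  shows "\<exists>u. \<forall>i\<in>I. \<forall>j\<in>I. Y i j = (\<Sum>a\<in>I. u a i * u a j)"
  using assms
proof (induction I arbitrary: Y rule: finite_induct)
  case (insert b I)
  let ?Q = "\<lambda>Y v. \<Sum>i\<in>I. \<Sum>j\<in>I. v i * Y i j * v j"
  have sym: "Y i j = Y j i" if "i \<in> insert b I" "j \<in> insert b I" for i j
    using insert.prems that unfolding sym_psd_on_def by blast
  have quad: "t\<^sup>2 * Y b b + 2 * t * (\<Sum>i\<in>I. v i * Y i b) + ?Q Y v \<ge> 0" for v t
  proof -
    let ?w = "v(b := t)"
    have w: "?w i = v i" if "i \<in> I" for i using that insert.hyps by auto
    have "0 \<le> (\<Sum>i\<in>insert b I. \<Sum>j\<in>insert b I. ?w i * Y i j * ?w j)"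
      using insert.prems unfolding sym_psd_on_def by blast
    also have "\<dots> = (t * Y b b * t + (\<Sum>j\<in>I. t * Y b j * ?w j)) + (\<Sum>i\<in>I. ?w i * Y i b * t + (\<Sum>j\<in>I. ?w i * Y i j * ?w j))"
      using insert.hyps by simp
    also have "\<dots> = (t * Y b b * t + (\<Sum>j\<in>I. t * Y b j * v j)) + (\<Sum>i\<in>I. v i * Y i b * t + (\<Sum>j\<in>I. v i * Y i j * v j))"
      using w by (intro arg_cong2[where f = "(+)"] refl sum.cong) auto
    also have "(\<Sum>j\<in>I. t * Y b j * v j) = t * (\<Sum>j\<in>I. v j * Y j b)"
      unfolding sum_distrib_left using sym by (intro sum.cong) auto
    also have "(\<Sum>i\<in>I. v i * Y i b * t + (\<Sum>j\<in>I. v i * Y i j * v j)) = t * (\<Sum>i\<in>I. v i * Y i b) + ?Q Y v"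
      by (simp add: sum.distrib sum_distrib_left mult_ac)
    finally show ?thesis by (simp add: power2_eq_square algebra_simps)
  qed
  have Ybb: "Y b b \<ge> 0" using quad[of 1 "\<lambda>_. 0"] by simp
  show ?case
  proof (cases "Y b b = 0")
    case True
    have zero: "Y i b = 0" if "i \<in> I" for i
    proof (rule ccontr)
      assume ne: "Y i b \<noteq> 0"
      define v where "v j = (of_bool (j = i) :: real)" for j
      have S: "(\<Sum>j\<in>I. v j * Y j b) = Y i b"
        using that insert.hyps by (simp add: v_def of_bool_def if_distrib[of "\<lambda>t. t * _"] sum.delta cong: if_cong)
      have "2 * t * Y i b + ?Q Y v \<ge> 0" for t
        using quad[of t v] unfolding S True by simp
      \<comment> \<open>With a zero diagonal entry the quadratic inequality \<open>quad\<close> is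
        affine in \<open>t\<close>; this \<open>t\<close> brings its value down to -1.\<close>
      moreover define t where "t = (- ?Q Y v - 1) / (2 * Y i b)"
      have "2 * t * Y i b = - ?Q Y v - 1" using ne by (simp add: t_def)
      ultimately show False by (smt (verit))
    qed
    have "sym_psd_on I Y" unfolding sym_psd_on_def using quad[of 0] sym by auto
    from insert.IH[OF this] obtain u where u: "\<forall>i\<in>I. \<forall>j\<in>I. Y i j = (\<Sum>a\<in>I. u a i * u a j)" ..
    define u' where "u' a i = (if a = b \<or> i = b then 0 else u a i)" for a i
    have "Y i j = (\<Sum>a\<in>insert b I. u' a i * u' a j)" if ij: "i \<in> insert b I" "j \<in> insert b I" for i j
    proof (cases "i = b \<or> j = b")
      case True
      hence "Y i j = 0" using ij zero sym \<open>Y b b = 0\<close> by (metis insertE)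
      moreover have "(\<Sum>a\<in>insert b I. u' a i * u' a j) = 0"
        using True by (intro sum.neutral) (auto simp: u'_def)
      ultimately show ?thesis by simp
    next
      case False
      hence "Y i j = (\<Sum>a\<in>I. u a i * u a j)" using u ij by auto
      also have "\<dots> = (\<Sum>a\<in>I. u' a i * u' a j)"
        using False insert.hyps by (intro sum.cong) (auto simp: u'_def)
      finally show ?thesis using insert.hyps by (simp add: u'_def)
    qed
    thus ?thesis by blast
  next
    case False
    with Ybb have pos: "Y b b > 0" by simp
    \<comment> \<open>The Schur complement of the entry at \<open>b\<close>. It is again positive
      semidefinite, by \<open>quad\<close> at its minimising value of \<open>t\<close>.\<close>
    define Y' where "Y' i j = Y i j - Y i b * Y b j / Y b b" for i j
    have "?Q Y' v \<ge> 0" for v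
    proof -
      let ?S = "\<Sum>i\<in>I. v i * Y i b"
      have "?Q Y' v = ?Q Y v - (\<Sum>i\<in>I. \<Sum>j\<in>I. (v i * Y i b) * (v j * Y j b) / Y b b)"
        unfolding sum_subtractf[symmetric] Y'_def
        using sym by (intro sum.cong refl) (auto simp: algebra_simps)
      also have "(\<Sum>i\<in>I. \<Sum>j\<in>I. (v i * Y i b) * (v j * Y j b) / Y b b) = ?S\<^sup>2 / Y b b"
        by (simp add: power2_eq_square sum_product sum_divide_distrib)
      finally have "?Q Y' v = ?Q Y v - ?S\<^sup>2 / Y b b" .
      moreover have "(- ?S / Y b b)\<^sup>2 * Y b b + 2 * (- ?S / Y b b) * ?S = - (?S\<^sup>2 / Y b b)"
        using pos by (simp add: power2_eq_square field_simps)
      ultimately show ?thesis using quad[of "- ?S / Y b b" v] by linarith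
    qed
    moreover have "Y' i j = Y' j i" if "i \<in> I" "j \<in> I" for i j
      using sym that by (simp add: Y'_def mult.commute)
    ultimately have "sym_psd_on I Y'" unfolding sym_psd_on_def by blast
    from insert.IH[OF this] obtain u where u: "\<forall>i\<in>I. \<forall>j\<in>I. Y' i j = (\<Sum>a\<in>I. u a i * u a j)" ..
    define u' where "u' a i = (if a = b then Y i b / sqrt (Y b b) else if i = b then 0 else u a i)" for a i
    have "Y i j = (\<Sum>a\<in>insert b I. u' a i * u' a j)" if ij: "i \<in> insert b I" "j \<in> insert b I" for i j
    proof -
      have hd: "u' b i * u' b j = Y i b * Y b j / Y b b"
        using pos sym[OF ij(2), of b] by (simp add: u'_def)
      have "(\<Sum>a\<in>I. u' a i * u' a j) = Y i j - Y i b * Y b j / Y b b"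
      proof (cases "i = b \<or> j = b")
        case True
        have "(\<Sum>a\<in>I. u' a i * u' a j) = 0"
          using True insert.hyps by (intro sum.neutral) (auto simp: u'_def)
        moreover have "Y i j - Y i b * Y b j / Y b b = 0" using True pos by auto
        ultimately show ?thesis by simp
      next
        case False
        hence "Y' i j = (\<Sum>a\<in>I. u a i * u a j)" using u ij by auto
        also have "\<dots> = (\<Sum>a\<in>I. u' a i * u' a j)"
          using False insert.hyps by (intro sum.cong) (auto simp: u'_def)
        finally show ?thesis by (simp add: Y'_def)
      qed
      thus ?thesis using hd insert.hyps by simp
    qed
    thus ?thesis by blast
  qed
qed auto

section \<open>Signs, links and localisation\<close>

lemma finite_subsets_of_size [simp]: "finite (subsets_of_size n i)"
  by (rule finite_subset[of _ "Pow {1..n}"]) (auto simp: subsets_of_size_def)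

lemma subsets_of_size_finite: "F \<in> subsets_of_size n i \<Longrightarrow> finite F"
  by (auto simp: subsets_of_size_def intro: finite_subset)

lemma card_subsets_of_size: "card (subsets_of_size n i) = n choose i"
  unfolding subsets_of_size_def using n_subsets[of "{1..n}" i] by simp

lemma incidence_square [simp]: "incidence F K * incidence F K = 1"
  by (simp add: incidence_def flip: power_mult_distrib)

lemma eps_sym: "eps F F' = eps F' F"
  by (auto simp: eps_def Int_commute mult.commute)

lemma eps_self [simp]: "eps F F = 0"
  by (simp add: eps_def)

lemma eps_insert:
  assumes "finite \<tau>" "x \<notin> \<tau>" "y \<notin> \<tau>" "x \<noteq> y"
  shows "eps (insert x \<tau>) (insert y \<tau>) = incidence (insert x \<tau>) \<tau> * incidence (insert y \<tau>) \<tau>"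
proof -
  have "insert x \<tau> \<inter> insert y \<tau> = \<tau>" "insert x \<tau> \<noteq> insert y \<tau>" using assms by auto
  thus ?thesis using assms by (simp add: eps_def)
qed

text \<open>For k-sets the sizes of union and intersection add up to 2k, so a common facet is the
  same as a union of size k + 1. Multiplying by the sign therefore undoes the sign.\<close>

lemma eps_cases:
  assumes "F \<in> subsets_of_size n k" "F' \<in> subsets_of_size n k"
  shows "eps F F' * eps F F' = of_bool (card (F \<union> F') = k + 1)"
proof -
  have fin: "finite F" "finite F'" using assms subsets_of_size_finite by auto
  have c: "card F = k" "card F' = k" using assms by (auto simp: subsets_of_size_def)
  have "card (F \<union> F') + card (F \<inter> F') = 2 * k" using card_Un_Int[OF fin] c by simp
  hence iff: "(F \<noteq> F' \<and> card F = card F' \<and> card (F \<inter> F') + 1 = card F) \<longleftrightarrow> card (F \<union> F') = k + 1"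
    using c by auto
  have "(a * b) * (a * b) = (a * a) * (b * b)" for a b :: real by simp
  hence "(incidence F K * incidence F' K) * (incidence F K * incidence F' K) = 1" for K
    by (simp only: incidence_square mult_1)
  thus ?thesis unfolding eps_def iff by simp
qed

text \<open>In a complex with complete (k-1)-skeleton every vertex outside the (k-1)-set
  \<open>\<tau>\<close> belongs to its link, so only the edges of the link are random.\<close>

definition link_vertices :: "nat \<Rightarrow> nat set \<Rightarrow> nat set" where
  "link_vertices n \<tau> = {1..n} - \<tau>"

definition link_label :: "nat set \<Rightarrow> nat \<Rightarrow> nat \<Rightarrow> nat set" where
  "link_label \<tau> x y = insert x (insert y \<tau>)"

lemma finite_link_vertices [simp]: "finite (link_vertices n \<tau>)"
  by (simp add: link_vertices_def)

lemma edge_labelling_link: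
  assumes "\<tau> \<in> subsets_of_size n (k - 1)" "k \<ge> 1"
  shows "edge_labelling (link_vertices n \<tau>) (subsets_of_size n (k + 1)) (link_label \<tau>)"
proof -
  have fin: "finite \<tau>" using assms(1) by (rule subsets_of_size_finite)
  have "link_label \<tau> x y \<in> subsets_of_size n (k + 1)"
    if "x \<in> link_vertices n \<tau>" "y \<in> link_vertices n \<tau>" "x \<noteq> y" for x y
    using that assms fin by (auto simp: link_label_def link_vertices_def subsets_of_size_def)
  moreover have "link_label \<tau> x y - \<tau> = {x, y}"
    if "x \<in> link_vertices n \<tau>" "y \<in> link_vertices n \<tau>" for x y
    using that by (auto simp: link_label_def link_vertices_def)
  moreover have "link_label \<tau> x y = {x, y} \<union> \<tau>" for x y by (auto simp: link_label_def)
  ultimately show ?thesis unfolding edge_labelling_def by (metis (no_types, lifting))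
qed

text \<open>Garland's localisation to the links of the \<open>(k - 1)\<close>-sets.\<close>
lemma sum_eps_localise:
  assumes "k \<ge> 1"
  shows "(\<Sum>F\<in>subsets_of_size n k. \<Sum>F'\<in>subsets_of_size n k. eps F F' * G F F') =
    (\<Sum>\<tau>\<in>subsets_of_size n (k - 1). \<Sum>x\<in>link_vertices n \<tau>. \<Sum>y\<in>link_vertices n \<tau> - {x}.
       incidence (insert x \<tau>) \<tau> * incidence (insert y \<tau>) \<tau> * G (insert x \<tau>) (insert y \<tau>))"
proof -
  let ?S = "subsets_of_size n k" and ?T = "subsets_of_size n (k - 1)"
  define P where "P = {(F, F'). F \<in> ?S \<and> F' \<in> ?S \<and> F \<noteq> F' \<and> card (F \<inter> F') + 1 = k}"
  define Q where "Q = (SIGMA \<tau>:?T. SIGMA x:link_vertices n \<tau>. link_vertices n \<tau> - {x})"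
  have "(\<Sum>F\<in>?S. \<Sum>F'\<in>?S. eps F F' * G F F') = (\<Sum>(F, F')\<in>?S \<times> ?S. eps F F' * G F F')"
    by (simp add: sum.cartesian_product)
  also have "\<dots> = (\<Sum>(F, F')\<in>P. eps F F' * G F F')"
  proof (rule sum.mono_neutral_right)
    show "\<forall>i\<in>?S \<times> ?S - P. (case i of (F, F') \<Rightarrow> eps F F' * G F F') = 0"
    proof clarify
      fix F F' assume F: "F \<in> ?S" "F' \<in> ?S" "(F, F') \<notin> P"
      hence "card F = k" by (simp add: subsets_of_size_def)
      hence "eps F F' = 0" using F by (auto simp: P_def eps_def)
      thus "eps F F' * G F F' = 0" by simp
    qed
  qed (auto simp: P_def)
  also have "\<dots> = (\<Sum>(\<tau>, x, y)\<in>Q. incidence (insert x \<tau>) \<tau> * incidence (insert y \<tau>) \<tau> * G (insert x \<tau>) (insert y \<tau>))"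
  \<comment> \<open>An ordered pair of k-sets with a common facet corresponds to that facet together
    with the two distinct vertices that complete it.\<close>
  proof (rule sum.reindex_bij_witness[of _
        "\<lambda>(\<tau>, x, y). (insert x \<tau>, insert y \<tau>)"
        "\<lambda>(F, F'). (F \<inter> F', the_elem (F - F'), the_elem (F' - F))"])
    fix FF assume "FF \<in> P"
    then obtain F F' where FF: "FF = (F, F')" "F \<in> ?S" "F' \<in> ?S" "card (F \<inter> F') + 1 = k"
      by (auto simp: P_def)
    have fin: "finite F" "finite F'" using FF subsets_of_size_finite by auto
    have "card (F - F') = 1" "card (F' - F) = 1"
      using FF fin card_Diff_subset_Int[of F F'] card_Diff_subset_Int[of F' F]
      by (auto simp: subsets_of_size_def Int_commute)
    then obtain x y where xy: "F - F' = {x}" "F' - F = {y}" by (meson card_1_singletonE)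
    define \<tau> where "\<tau> = F \<inter> F'"
    have F: "F = insert x \<tau>" "F' = insert y \<tau>" "x \<notin> \<tau>" "y \<notin> \<tau>" "x \<noteq> y"
      using xy unfolding \<tau>_def by blast+
    have el: "the_elem (F - F') = x" "the_elem (F' - F) = y" using xy by auto
    have t: "\<tau> \<in> ?T" "finite \<tau>" "x \<in> {1..n}" "y \<in> {1..n}"
      using FF fin F unfolding \<tau>_def by (auto simp: subsets_of_size_def)
    show "(case case FF of (F, F') \<Rightarrow> (F \<inter> F', the_elem (F - F'), the_elem (F' - F)) of
        (\<tau>, x, y) \<Rightarrow> (insert x \<tau>, insert y \<tau>)) = FF"
      by (simp only: FF(1) prod.case el \<tau>_def[symmetric] F(1,2)[symmetric])
    show "(case FF of (F, F') \<Rightarrow> (F \<inter> F', the_elem (F - F'), the_elem (F' - F))) \<in> Q"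
      unfolding FF(1) prod.case el \<tau>_def[symmetric]
      using t F(3-5) by (simp add: Q_def link_vertices_def)
    show "(case case FF of (F, F') \<Rightarrow> (F \<inter> F', the_elem (F - F'), the_elem (F' - F)) of
        (\<tau>, x, y) \<Rightarrow> incidence (insert x \<tau>) \<tau> * incidence (insert y \<tau>) \<tau> * G (insert x \<tau>) (insert y \<tau>)) =
        (case FF of (F, F') \<Rightarrow> eps F F' * G F F')"
      using eps_insert[OF t(2) F(3-5)]
      by (simp only: FF(1) prod.case el \<tau>_def[symmetric] F(1,2)[symmetric])
  next
    fix q assume "q \<in> Q"
    then obtain \<tau> x y where q: "q = (\<tau>, x, y)" "\<tau> \<in> ?T" "x \<in> link_vertices n \<tau>" "y \<in> link_vertices n \<tau>" "x \<noteq> y"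
      by (auto simp: Q_def)
    have fin: "finite \<tau>" using q(2) by (rule subsets_of_size_finite)
    have xy: "x \<notin> \<tau>" "y \<notin> \<tau>" "x \<in> {1..n}" "y \<in> {1..n}" using q by (auto simp: link_vertices_def)
    have int: "insert x \<tau> \<inter> insert y \<tau> = \<tau>" "insert x \<tau> - insert y \<tau> = {x}" "insert y \<tau> - insert x \<tau> = {y}"
      using xy q(5) by auto
    show "(case case q of (\<tau>, x, y) \<Rightarrow> (insert x \<tau>, insert y \<tau>) of
        (F, F') \<Rightarrow> (F \<inter> F', the_elem (F - F'), the_elem (F' - F))) = q"
      by (simp add: q(1) int)
    show "(case q of (\<tau>, x, y) \<Rightarrow> (insert x \<tau>, insert y \<tau>)) \<in> P"
      using q(2,5) xy fin assms int(1) by (auto simp: q(1) P_def subsets_of_size_def)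
  qed
  also have "\<dots> = (\<Sum>\<tau>\<in>?T. \<Sum>x\<in>link_vertices n \<tau>. \<Sum>y\<in>link_vertices n \<tau> - {x}.
       incidence (insert x \<tau>) \<tau> * incidence (insert y \<tau>) \<tau> * G (insert x \<tau>) (insert y \<tau>))"
    unfolding Q_def by (simp add: sum.Sigma)
  finally show ?thesis .
qed

text \<open>Each k-set arises k times, once for every vertex that can be removed from it.\<close>

lemma sum_links:
  fixes h :: "nat set \<Rightarrow> real"
  assumes "k \<ge> 1"
  shows "(\<Sum>\<tau>\<in>subsets_of_size n (k - 1). \<Sum>x\<in>link_vertices n \<tau>. h (insert x \<tau>)) =
    real k * (\<Sum>F\<in>subsets_of_size n k. h F)"
proof -
  let ?S = "subsets_of_size n k" and ?T = "subsets_of_size n (k - 1)"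
  have "(\<Sum>\<tau>\<in>?T. \<Sum>x\<in>link_vertices n \<tau>. h (insert x \<tau>))
      = (\<Sum>(\<tau>, x)\<in>(SIGMA \<tau>:?T. link_vertices n \<tau>). h (insert x \<tau>))"
    by (simp add: sum.Sigma)
  also have "\<dots> = (\<Sum>(F, x)\<in>(SIGMA F:?S. F). h F)"
    by (rule sum.reindex_bij_witness[of _ "\<lambda>(F, x). (F - {x}, x)" "\<lambda>(\<tau>, x). (insert x \<tau>, x)"])
      (use assms in \<open>auto simp: link_vertices_def subsets_of_size_def card_insert_if insert_absorb dest: finite_subset\<close>)
  also have "\<dots> = (\<Sum>F\<in>?S. \<Sum>x\<in>F. h F)"
    by (rule sum.Sigma[symmetric]) (auto simp: subsets_of_size_finite)
  also have "\<dots> = (\<Sum>F\<in>?S. real k * h F)"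
    by (intro sum.cong) (auto simp: subsets_of_size_def)
  finally show ?thesis by (simp add: sum_distrib_left)
qed

text \<open>This is positive semidefiniteness of \<open>L_down\<close>. In each link the signs are
  absorbed into \<open>f\<close>, and the off-diagonal form of the all-ones matrix equals (sum f)^2
  - sum f^2.\<close>

lemma eps_form_lower:
  assumes k: "k \<ge> 1"
  shows "(\<Sum>F\<in>subsets_of_size n k. \<Sum>F'\<in>subsets_of_size n k. eps F F' * (v F * v F')) \<ge> - real k * (\<Sum>F\<in>subsets_of_size n k. (v F)\<^sup>2)"
proof -
  let ?f = "\<lambda>\<tau> x. incidence (insert x \<tau>) \<tau> * v (insert x \<tau>)"
  let ?T = "subsets_of_size n (k - 1)"
  have "- real k * (\<Sum>F\<in>subsets_of_size n k. (v F)\<^sup>2) = (\<Sum>\<tau>\<in>?T. - (\<Sum>x\<in>link_vertices n \<tau>. (?f \<tau> x)\<^sup>2))"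
    using sum_links[OF k, where n = n and h = "\<lambda>F. (v F)\<^sup>2"]
    by (simp add: power_mult_distrib power2_eq_square[of "incidence _ _"] sum_negf)
  also have "\<dots> \<le> (\<Sum>\<tau>\<in>?T. \<Sum>x\<in>link_vertices n \<tau>. \<Sum>y\<in>link_vertices n \<tau> - {x}. ?f \<tau> x * ?f \<tau> y)"
  proof (rule sum_mono)
    fix \<tau>
    let ?W = "link_vertices n \<tau>"
    have "(\<Sum>x\<in>?W. \<Sum>y\<in>?W - {x}. ?f \<tau> x * ?f \<tau> y) = (\<Sum>x\<in>?W. (\<Sum>y\<in>?W. ?f \<tau> x * ?f \<tau> y) - (?f \<tau> x)\<^sup>2)"
      by (intro sum.cong refl) (simp add: sum_diff1 power2_eq_square)
    also have "\<dots> = (\<Sum>x\<in>?W. ?f \<tau> x)\<^sup>2 - (\<Sum>x\<in>?W. (?f \<tau> x)\<^sup>2)"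
      by (simp add: sum_subtractf power2_eq_square sum_product)
    finally show "- (\<Sum>x\<in>?W. (?f \<tau> x)\<^sup>2) \<le> (\<Sum>x\<in>?W. \<Sum>y\<in>?W - {x}. ?f \<tau> x * ?f \<tau> y)" by simp
  qed
  also have "\<dots> = (\<Sum>F\<in>subsets_of_size n k. \<Sum>F'\<in>subsets_of_size n k. eps F F' * (v F * v F'))"
    unfolding sum_eps_localise[OF k] by (intro sum.cong refl) (simp add: mult_ac)
  finally show ?thesis .
qed

lemma trace_L_down:
  "trace_on (subsets_of_size n k) (mat_mult_on (subsets_of_size n k) (L_down k) Y) =
    real k * trace_on (subsets_of_size n k) Y + (\<Sum>F\<in>subsets_of_size n k. \<Sum>F'\<in>subsets_of_size n k. eps F F' * Y F' F)"
proof -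
  have "trace_on (subsets_of_size n k) (mat_mult_on (subsets_of_size n k) (L_down k) Y)
      = (\<Sum>F\<in>subsets_of_size n k. \<Sum>F'\<in>subsets_of_size n k. (if F = F' then real k * Y F F else 0) + eps F F' * Y F' F)"
    unfolding trace_on_def mat_mult_on_def L_down_def by (intro sum.cong refl) auto
  also have "\<dots> = (\<Sum>F\<in>subsets_of_size n k. real k * Y F F + (\<Sum>F'\<in>subsets_of_size n k. eps F F' * Y F' F))"
    by (intro sum.cong refl) (simp add: sum.distrib sum.delta)
  finally show ?thesis by (simp add: sum.distrib trace_on_def sum_distrib_left)
qed

lemma Un_ksets_mem:
  assumes "F \<in> subsets_of_size n k" "F' \<in> subsets_of_size n k" "card (F \<union> F') = k + 1"
  shows "F \<union> F' \<in> subsets_of_size n (k + 1)"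
  using assms by (auto simp: subsets_of_size_def)

definition complex_of_coins :: "nat \<Rightarrow> nat \<Rightarrow> (nat set \<Rightarrow> bool) \<Rightarrow> nat set set" where
  "complex_of_coins k n \<beta> = {F. F \<subseteq> {1..n} \<and> card F \<le> k} \<union> {F \<in> subsets_of_size n (k + 1). \<beta> F}"

lemma faces_complex_of_coins: "faces k (complex_of_coins k n \<beta>) = {F \<in> subsets_of_size n (k + 1). \<beta> F}"
  by (auto simp: faces_def complex_of_coins_def subsets_of_size_def)

section \<open>Deterministic bounds for one outcome whose link matrices all have norm at most
  M\<close>

context
  fixes k n :: nat and p M :: real and \<beta> :: "nat set \<Rightarrow> bool"
  assumes k: "k \<ge> 1"
    and norm: "\<And>\<tau> f. \<tau> \<in> subsets_of_size n (k - 1) \<Longrightarrow>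
      \<bar>bilin (link_vertices n \<tau>) (centred_adj p (link_label \<tau>) \<beta>) f f\<bar> \<le> M * (\<Sum>x\<in>link_vertices n \<tau>. (f x)\<^sup>2)"
begin

abbreviation (input) "ksets \<equiv> subsets_of_size n k"

lemma link_bilin:
  "bilin (link_vertices n \<tau>) (centred_adj p (link_label \<tau>) \<beta>) f g =
    (\<Sum>x\<in>link_vertices n \<tau>. \<Sum>y\<in>link_vertices n \<tau> - {x}. f x * (of_bool (\<beta> (insert x \<tau> \<union> insert y \<tau>)) - p) * g y)"
proof -
  have eq: "insert x \<tau> \<union> insert y \<tau> = link_label \<tau> x y" for x y by (auto simp: link_label_def)
  show ?thesis unfolding bilin_def eq
    by (intro sum.cong refl sum.mono_neutral_cong_right) (auto simp: centred_adj_def)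
qed

text \<open>Within a link the product of incidences is a conjugation by a diagonal sign matrix,
  which does not change norms. The factor k is the overlap of the links in
  \<open>sum_links\<close>.\<close>

lemma eps_form_bound:
  "\<bar>\<Sum>F\<in>ksets. \<Sum>F'\<in>ksets. eps F F' * ((of_bool (\<beta> (F \<union> F')) - p) * v F * v F')\<bar>
    \<le> real k * M * (\<Sum>F\<in>ksets. (v F)\<^sup>2)"
proof -
  let ?f = "\<lambda>\<tau> x. incidence (insert x \<tau>) \<tau> * v (insert x \<tau>)"
  have "(\<Sum>F\<in>ksets. \<Sum>F'\<in>ksets. eps F F' * ((of_bool (\<beta> (F \<union> F')) - p) * v F * v F')) =
      (\<Sum>\<tau>\<in>subsets_of_size n (k - 1). bilin (link_vertices n \<tau>) (centred_adj p (link_label \<tau>) \<beta>) (?f \<tau>) (?f \<tau>))"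
    unfolding sum_eps_localise[OF k] link_bilin by (intro sum.cong refl) (simp add: mult_ac)
  also have "\<bar>\<dots>\<bar> \<le> (\<Sum>\<tau>\<in>subsets_of_size n (k - 1). M * (\<Sum>x\<in>link_vertices n \<tau>. (?f \<tau> x)\<^sup>2))"
    by (intro order_trans[OF sum_abs] sum_mono norm)
  also have "\<dots> = (\<Sum>\<tau>\<in>subsets_of_size n (k - 1). M * (\<Sum>x\<in>link_vertices n \<tau>. (v (insert x \<tau>))\<^sup>2))"
    by (simp add: power_mult_distrib power2_eq_square[of "incidence _ _"])
  also have "\<dots> = M * (real k * (\<Sum>F\<in>ksets. (v F)\<^sup>2))"
    unfolding sum_links[OF k, symmetric, where h = "\<lambda>F. (v F)\<^sup>2"] by (simp add: sum_distrib_left)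
  finally show ?thesis by (simp add: mult_ac)
qed

text \<open>Dual certificate: \<open>Y\<close> vanishes on the faces, so \<open>L\<^sup>\<down>\<close> may be replaced by its centred version.\<close>
lemma theta_value_upper:
  assumes "p > 0" "theta_feasible k n (complex_of_coins k n \<beta>) Y"
  shows "trace_on ksets (mat_mult_on ksets (L_down k) Y) \<le> real k + real k * M / p"
proof -
  have psd: "sym_psd_on ksets Y" and tr: "trace_on ksets Y = 1"
    and face: "\<And>F F'. F \<in> ksets \<Longrightarrow> F' \<in> ksets \<Longrightarrow> F \<union> F' \<in> faces k (complex_of_coins k n \<beta>) \<Longrightarrow> Y F F' = 0"
    using assms(2) unfolding theta_feasible_def Let_def by blast+
  obtain u where u: "\<And>F F'. F \<in> ksets \<Longrightarrow> F' \<in> ksets \<Longrightarrow> Y F F' = (\<Sum>a\<in>ksets. u a F * u a F')"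
    using gram_representation[OF _ psd] by auto
  have vanish: "eps F F' * of_bool (\<beta> (F \<union> F')) * Y F' F = 0" if "F \<in> ksets" "F' \<in> ksets" for F F'
  proof (cases "eps F F' = 0 \<or> \<not> \<beta> (F \<union> F')")
    case False
    hence "card (F \<union> F') = k + 1" using eps_cases[OF that] by (cases "card (F \<union> F') = k + 1") auto
    hence "F' \<union> F \<in> faces k (complex_of_coins k n \<beta>)"
      using False Un_ksets_mem[OF that] by (simp add: faces_complex_of_coins Un_commute)
    thus ?thesis using face that by simp
  qed auto
  \<comment> \<open>Where the coin is 1 the product of \<open>eps\<close> and \<open>Y\<close>
    vanishes, so the centred coin acts as the constant -p on the support of \<open>eps\<close> and
    \<open>Y\<close>. Dividing by -p produces the centred form.\<close>
  have "eps F F' * Y F' F = - (1 / p) * (\<Sum>a\<in>ksets. eps F F' * ((of_bool (\<beta> (F \<union> F')) - p) * u a F * u a F'))"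
    if "F \<in> ksets" "F' \<in> ksets" for F F'
  proof -
    have "eps F F' * Y F' F = - (1 / p) * (eps F F' * of_bool (\<beta> (F \<union> F')) * Y F' F - p * eps F F' * Y F' F)"
      unfolding vanish[OF that] using assms(1) by simp
    also have "\<dots> = - (1 / p) * (eps F F' * ((of_bool (\<beta> (F \<union> F')) - p) * Y F' F))"
      by (simp add: algebra_simps)
    also have "\<dots> = - (1 / p) * (eps F F' * ((of_bool (\<beta> (F \<union> F')) - p) * (\<Sum>a\<in>ksets. u a F * u a F')))"
      using u[OF that(2,1)] by (simp add: mult.commute)
    finally show ?thesis by (simp only: sum_distrib_left mult.assoc)
  qed
  hence "(\<Sum>F\<in>ksets. \<Sum>F'\<in>ksets. eps F F' * Y F' F) =
      (\<Sum>F\<in>ksets. \<Sum>F'\<in>ksets. \<Sum>a\<in>ksets. - (1 / p) * (eps F F' * ((of_bool (\<beta> (F \<union> F')) - p) * u a F * u a F')))"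
    by (simp add: sum_distrib_left)
  also have "\<dots> = (\<Sum>F\<in>ksets. \<Sum>a\<in>ksets. \<Sum>F'\<in>ksets. - (1 / p) * (eps F F' * ((of_bool (\<beta> (F \<union> F')) - p) * u a F * u a F')))"
    by (intro sum.cong refl sum.swap)
  also have "\<dots> = (\<Sum>a\<in>ksets. \<Sum>F\<in>ksets. \<Sum>F'\<in>ksets. - (1 / p) * (eps F F' * ((of_bool (\<beta> (F \<union> F')) - p) * u a F * u a F')))"
    by (rule sum.swap)
  also have "\<dots> = (\<Sum>a\<in>ksets. - (1 / p) * (\<Sum>F\<in>ksets. \<Sum>F'\<in>ksets. eps F F' * ((of_bool (\<beta> (F \<union> F')) - p) * u a F * u a F')))"
    by (simp only: sum_distrib_left)
  also have "\<dots> \<le> (\<Sum>a\<in>ksets. (1 / p) * (real k * M * (\<Sum>F\<in>ksets. (u a F)\<^sup>2)))"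
  proof (rule sum_mono)
    fix a
    let ?Z = "\<Sum>F\<in>ksets. \<Sum>F'\<in>ksets. eps F F' * ((of_bool (\<beta> (F \<union> F')) - p) * u a F * u a F')"
    have "- ?Z \<le> real k * M * (\<Sum>F\<in>ksets. (u a F)\<^sup>2)" using eps_form_bound[of "u a"] by linarith
    hence "(1 / p) * (- ?Z) \<le> (1 / p) * (real k * M * (\<Sum>F\<in>ksets. (u a F)\<^sup>2))"
      using assms(1) by (intro mult_left_mono) auto
    thus "- (1 / p) * ?Z \<le> (1 / p) * (real k * M * (\<Sum>F\<in>ksets. (u a F)\<^sup>2))" by simp
  qed
  also have "\<dots> = real k * M / p * (\<Sum>a\<in>ksets. \<Sum>F\<in>ksets. (u a F)\<^sup>2)"
    by (simp add: sum_distrib_left)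
  also have "(\<Sum>a\<in>ksets. \<Sum>F\<in>ksets. (u a F)\<^sup>2) = (\<Sum>F\<in>ksets. \<Sum>a\<in>ksets. (u a F)\<^sup>2)"
    by (rule sum.swap)
  also have "\<dots> = trace_on ksets Y"
    unfolding trace_on_def using u by (intro sum.cong) (auto simp: power2_eq_square)
  finally show ?thesis unfolding trace_L_down tr by simp
qed

text \<open>On non-faces 1 - b = q - (b - p) for the coin b. The first part is controlled by
  \<open>eps_form_lower\<close>, the second by \<open>eps_form_bound\<close>, so the signed non-face
  form is at least -k (q + M) |v|^2. The trace then counts non-faces link by link.\<close>

lemma theta_value_lower:
  assumes "p \<le> 1" "M > 0" "k \<le> n"
  obtains Y where "theta_feasible k n (complex_of_coins k n \<beta>) Y"
    "trace_on ksets (mat_mult_on ksets (L_down k) Y) \<ge> ((1 - p) * (real n - real k) - M) / ((1 - p) + M)"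
proof -
  define m where "m = real (card ksets)"
  have m: "m > 0" using assms(3) by (simp add: m_def card_subsets_of_size)
  define q where "q = 1 - p"
  have q: "q \<ge> 0" using assms(1) by (simp add: q_def)
  \<comment> \<open>The weight for which the identity exactly compensates the lower bound -k (q + M)
    of the signed non-face form.\<close>
  define t where "t = 1 / (real k * (q + M))"
  have "real k * (q + M) > 0" using q assms(2) k by (intro mult_pos_pos) auto
  moreover have "1 / x > 0" "1 / x * x = 1" if "x > 0" for x :: real using that by simp_all
  ultimately have t: "t > 0" "t * (real k * q + real k * M) = 1"
    unfolding t_def distrib_left[symmetric] by blast+
  define Y where "Y F F' = (of_bool (F = F') + t * eps F F' * (1 - of_bool (\<beta> (F \<union> F')))) / m" for F F'
  have tr: "trace_on ksets Y = 1" using m by (auto simp: trace_on_def Y_def m_def card_gt_0_iff)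
  have psd: "sym_psd_on ksets Y"
    unfolding sym_psd_on_def
  proof (intro conjI ballI allI)
    show "Y F F' = Y F' F" for F F' by (auto simp: Y_def eps_sym[of F F'] Un_commute)
    fix v :: "nat set \<Rightarrow> real"
    let ?s = "\<Sum>F\<in>ksets. (v F)\<^sup>2"
    let ?A = "\<Sum>F\<in>ksets. \<Sum>F'\<in>ksets. eps F F' * (v F * v F')"
    let ?B = "\<Sum>F\<in>ksets. \<Sum>F'\<in>ksets. eps F F' * ((of_bool (\<beta> (F \<union> F')) - p) * v F * v F')"
    have "(\<Sum>F\<in>ksets. \<Sum>F'\<in>ksets. v F * Y F F' * v F') =
        (\<Sum>F\<in>ksets. \<Sum>F'\<in>ksets. (if F = F' then (v F)\<^sup>2 / m else 0) + (t * q / m * (eps F F' * (v F * v F'))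
          - t / m * (eps F F' * ((of_bool (\<beta> (F \<union> F')) - p) * v F * v F'))))"
      by (intro sum.cong refl) (auto simp: Y_def q_def power2_eq_square diff_divide_distrib add_divide_distrib algebra_simps)
    also have "\<dots> = ?s / m + (t * q / m * ?A - t / m * ?B)"
      by (simp add: sum.distrib sum_subtractf sum.delta sum_distrib_left sum_divide_distrib)
    also have "\<dots> \<ge> ?s / m + (t * q / m * (- real k * ?s) - t / m * (real k * M * ?s))"
      using eps_form_lower[OF k, where v = v and n = n] eps_form_bound[of v] t(1) m q
      by (intro add_left_mono diff_mono mult_left_mono) auto
    also have "?s / m + (t * q / m * (- real k * ?s) - t / m * (real k * M * ?s)) = ?s / m * (1 - t * (real k * q + real k * M))"
      using m by (simp add: field_simps)
    also have "\<dots> = 0" using t(2) by simp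
    finally show "(\<Sum>F\<in>ksets. \<Sum>F'\<in>ksets. v F * Y F F' * v F') \<ge> 0" .
  qed
  have neq: "F \<noteq> F'" if "F \<in> ksets" "F' \<in> ksets" "card (F \<union> F') \<ge> k + 1" for F F'
    using that by (auto simp: subsets_of_size_def)
  have feas: "theta_feasible k n (complex_of_coins k n \<beta>) Y"
    unfolding theta_feasible_def Let_def
  proof (intro conjI ballI impI psd tr)
    fix F F' assume F: "F \<in> ksets" "F' \<in> ksets"
    {
      assume "F \<union> F' \<in> faces k (complex_of_coins k n \<beta>)"
      hence "\<beta> (F \<union> F')" "card (F \<union> F') = k + 1"
        by (auto simp: faces_complex_of_coins subsets_of_size_def)
      thus "Y F F' = 0" using neq[OF F] by (simp add: Y_def)
    next
      assume c: "k + 2 \<le> card (F \<union> F')"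
      hence "eps F F' * eps F F' = 0" using eps_cases[OF F] by simp
      hence "eps F F' = 0" by simp
      thus "Y F F' = 0" using neq[OF F] c by (simp add: Y_def)
    next
      fix G G' assume G: "G \<in> ksets" "G' \<in> ksets" and eq: "F \<union> F' = G \<union> G' \<and> card (F \<union> F') = k + 1"
      have "eps F F' * Y F F' = t * (1 - of_bool (\<beta> (F \<union> F'))) / m"
        if "F \<in> ksets" "F' \<in> ksets" "card (F \<union> F') = k + 1" for F F'
      proof -
        have "eps F F' * Y F F' = (eps F F' * eps F F') * (t * (1 - of_bool (\<beta> (F \<union> F'))) / m)"
          using neq[OF that(1,2)] that(3) by (simp add: Y_def)
        thus ?thesis using eps_cases[OF that(1,2)] that(3) by simp
      qed
      note entry = this
      have e: "F \<union> F' = G \<union> G'" "card (F \<union> F') = k + 1" using eq by blast+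
      hence "card (G \<union> G') = k + 1" by simp
      with entry[OF F e(2)] entry[OF G this] show "eps F F' * Y F F' = eps G G' * Y G G'"
        by (simp only: e(1))
    }
  qed
  let ?T = "subsets_of_size n (k - 1)"
  have "(\<Sum>F\<in>ksets. \<Sum>F'\<in>ksets. eps F F' * Y F' F) =
      (\<Sum>F\<in>ksets. \<Sum>F'\<in>ksets. t / m * (eps F F' * (eps F F' * (1 - of_bool (\<beta> (F \<union> F'))))))"
  proof (intro sum.cong refl)
    fix F F'
    show "eps F F' * Y F' F = t / m * (eps F F' * (eps F F' * (1 - of_bool (\<beta> (F \<union> F')))))"
      by (cases "F = F'") (auto simp: Y_def eps_sym[of F' F] Un_commute)
  qed
  also have "\<dots> = t / m * (\<Sum>F\<in>ksets. \<Sum>F'\<in>ksets. eps F F' * (eps F F' * (1 - of_bool (\<beta> (F \<union> F')))))"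
    by (simp only: sum_distrib_left)
  also have "(\<Sum>F\<in>ksets. \<Sum>F'\<in>ksets. eps F F' * (eps F F' * (1 - of_bool (\<beta> (F \<union> F'))))) =
      (\<Sum>\<tau>\<in>?T. \<Sum>x\<in>link_vertices n \<tau>. \<Sum>y\<in>link_vertices n \<tau> - {x}. 1 - of_bool (\<beta> (insert x \<tau> \<union> insert y \<tau>)))"
    unfolding sum_eps_localise[OF k]
  proof (intro sum.cong refl)
    fix \<tau> x y assume "\<tau> \<in> ?T" "x \<in> link_vertices n \<tau>" "y \<in> link_vertices n \<tau> - {x}"
    hence e: "eps (insert x \<tau>) (insert y \<tau>) = incidence (insert x \<tau>) \<tau> * incidence (insert y \<tau>) \<tau>"
      by (intro eps_insert) (auto simp: link_vertices_def dest: subsets_of_size_finite)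
    have "a * b * (a * b * c) = (a * a) * (b * b) * c" for a b c :: real by simp
    thus "incidence (insert x \<tau>) \<tau> * incidence (insert y \<tau>) \<tau> * (eps (insert x \<tau>) (insert y \<tau>) *
        (1 - of_bool (\<beta> (insert x \<tau> \<union> insert y \<tau>)))) = 1 - of_bool (\<beta> (insert x \<tau> \<union> insert y \<tau>))"
      unfolding e by (simp only: incidence_square mult_1)
  qed
  finally have val: "(\<Sum>F\<in>ksets. \<Sum>F'\<in>ksets. eps F F' * Y F' F) = t / m *
      (\<Sum>\<tau>\<in>?T. \<Sum>x\<in>link_vertices n \<tau>. \<Sum>y\<in>link_vertices n \<tau> - {x}. 1 - of_bool (\<beta> (insert x \<tau> \<union> insert y \<tau>)))" .
  have "real k * (m * (q * (real n - real k) - M)) = (\<Sum>\<tau>\<in>?T. \<Sum>x\<in>link_vertices n \<tau>. q * (real n - real k) - M)"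
    using sum_links[OF k, where n = n and h = "\<lambda>_. q * (real n - real k) - M"] by (simp add: m_def)
  also have "\<dots> \<le> (\<Sum>\<tau>\<in>?T. \<Sum>x\<in>link_vertices n \<tau>. \<Sum>y\<in>link_vertices n \<tau> - {x}. 1 - of_bool (\<beta> (insert x \<tau> \<union> insert y \<tau>)))"
  proof (rule sum_mono)
    fix \<tau> assume \<tau>: "\<tau> \<in> ?T"
    let ?W = "link_vertices n \<tau>"
    have "card \<tau> = k - 1" "\<tau> \<subseteq> {1..n}" using \<tau> by (auto simp: subsets_of_size_def)
    hence "card ?W = n - (k - 1)"
      unfolding link_vertices_def using subsets_of_size_finite[OF \<tau>] by (simp add: card_Diff_subset)
    \<comment> \<open>A link has n - k + 1 vertices, so each of them has n - k potential neighbours;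
      this is the n - k of the bound.\<close>
    hence W: "real (card ?W) = real n - real k + 1" using k assms(3) by (simp add: of_nat_diff)
    have "(\<Sum>x\<in>?W. \<Sum>y\<in>?W - {x}. 1 - of_bool (\<beta> (insert x \<tau> \<union> insert y \<tau>))) =
        (\<Sum>x\<in>?W. \<Sum>y\<in>?W - {x}. q - 1 * (of_bool (\<beta> (insert x \<tau> \<union> insert y \<tau>)) - p) * 1)"
      by (simp add: q_def)
    \<comment> \<open>The number of missing ordered pairs in a link is estimated by testing its
      centred adjacency matrix at the all-ones vector.\<close>
    also have "\<dots> = (\<Sum>x\<in>?W. \<Sum>y\<in>?W - {x}. q) - bilin ?W (centred_adj p (link_label \<tau>) \<beta>) (\<lambda>_. 1) (\<lambda>_. 1)"
      unfolding link_bilin by (simp only: sum_subtractf)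
    also have "(\<Sum>x\<in>?W. \<Sum>y\<in>?W - {x}. q) = (\<Sum>x\<in>?W. q * (real n - real k))"
    proof (rule sum.cong[OF refl])
      fix x assume "x \<in> ?W"
      hence "real (card (?W - {x})) = real (card ?W) - 1"
        by (metis card_Diff_singleton card_gt_0_iff empty_iff finite_link_vertices of_nat_1 of_nat_diff Suc_leI One_nat_def)
      thus "(\<Sum>y\<in>?W - {x}. q) = q * (real n - real k)" using W by simp
    qed
    finally have "(\<Sum>x\<in>?W. \<Sum>y\<in>?W - {x}. 1 - of_bool (\<beta> (insert x \<tau> \<union> insert y \<tau>))) =
        (\<Sum>x\<in>?W. q * (real n - real k)) - bilin ?W (centred_adj p (link_label \<tau>) \<beta>) (\<lambda>_. 1) (\<lambda>_. 1)" .
    moreover have "bilin ?W (centred_adj p (link_label \<tau>) \<beta>) (\<lambda>_. 1) (\<lambda>_. 1) \<le> (\<Sum>x\<in>?W. M)"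
      using norm[OF \<tau>, of "\<lambda>_. 1"] by (simp add: mult.commute)
    moreover have "(\<Sum>x\<in>?W. q * (real n - real k) - M) = (\<Sum>x\<in>?W. q * (real n - real k)) - (\<Sum>x\<in>?W. M)"
      by (rule sum_subtractf)
    ultimately show "(\<Sum>x\<in>?W. q * (real n - real k) - M)
        \<le> (\<Sum>x\<in>?W. \<Sum>y\<in>?W - {x}. 1 - of_bool (\<beta> (insert x \<tau> \<union> insert y \<tau>)))"
      by linarith
  qed
  finally have "t / m * (real k * (m * (q * (real n - real k) - M))) \<le> (\<Sum>F\<in>ksets. \<Sum>F'\<in>ksets. eps F F' * Y F' F)"
    unfolding val using t(1) m by (intro mult_left_mono) auto
  moreover have "t / m * (real k * (m * (q * (real n - real k) - M))) = (q * (real n - real k) - M) / (q + M)"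
  proof -
    have "1 / (a * s) / b * (a * (b * x)) = x / s" if "a \<noteq> 0" "b \<noteq> 0" for a b s x :: real
      using that by simp
    thus ?thesis unfolding t_def using m k by simp
  qed
  ultimately have "trace_on ksets (mat_mult_on ksets (L_down k) Y) \<ge> (q * (real n - real k) - M) / (q + M)"
    unfolding trace_L_down tr by simp
  thus ?thesis using that feas unfolding q_def by blast
qed

text \<open>The upper estimate for all feasible matrices bounds the set of values and the explicit
  one makes it nonempty, so the real supremum in \<open>theta\<close> behaves as intended.\<close>

lemma theta_bounds:
  assumes "0 < p" "p \<le> 1" "M > 0" "k \<le> n"
  shows "((1 - p) * (real n - real k) - M) / ((1 - p) + M) \<le> theta k n (complex_of_coins k n \<beta>)"
    and "theta k n (complex_of_coins k n \<beta>) \<le> real k + real k * M / p"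
proof -
  let ?S = "{trace_on ksets (mat_mult_on ksets (L_down k) Y) | Y. theta_feasible k n (complex_of_coins k n \<beta>) Y}"
  have ub: "s \<le> real k + real k * M / p" if "s \<in> ?S" for s
    using that theta_value_upper[OF assms(1)] by auto
  hence bdd: "bdd_above ?S" by (rule bdd_aboveI)
  obtain Y where Y: "theta_feasible k n (complex_of_coins k n \<beta>) Y"
    "trace_on ksets (mat_mult_on ksets (L_down k) Y) \<ge> ((1 - p) * (real n - real k) - M) / ((1 - p) + M)"
    using theta_value_lower[OF assms(2-4)] by blast
  have "trace_on ksets (mat_mult_on ksets (L_down k) Y) \<le> theta k n (complex_of_coins k n \<beta>)"
    unfolding theta_def using Y(1) by (intro cSup_upper bdd) auto
  thus "((1 - p) * (real n - real k) - M) / ((1 - p) + M) \<le> theta k n (complex_of_coins k n \<beta>)" using Y(2) by simp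
  show "theta k n (complex_of_coins k n \<beta>) \<le> real k + real k * M / p"
    unfolding theta_def using Y(1) ub by (intro cSup_least) auto
qed

end

section \<open>Concentration\<close>

text \<open>Supplies the moment order, which must be a power of two; being off by a factor 2 changes
  only constants.\<close>

lemma ex_power_of_two_between:
  fixes x :: real
  assumes "x > 1"
  shows "\<exists>j\<ge>1. x \<le> 2 ^ j \<and> 2 ^ j \<le> 2 * x"
proof -
  define j where "j = (LEAST j. x \<le> 2 ^ j)"
  obtain i where "x < 2 ^ i" using real_arch_pow[of 2 x] by auto
  hence j: "x \<le> 2 ^ j" unfolding j_def by (intro LeastI[where P = "\<lambda>j. x \<le> 2 ^ j"]) (rule less_imp_le)
  have "j \<noteq> 0" using j assms by (intro notI) simp
  then obtain l where l: "j = Suc l" by (cases j) auto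
  have "\<not> x \<le> 2 ^ l" using not_less_Least[of l "\<lambda>j. x \<le> 2 ^ j"] l unfolding j_def by simp
  thus ?thesis using j l by (intro exI[of _ j]) auto
qed

text \<open>The 2 is sqrt(4), from N <= 4npq in the threshold
  \<open>exp 1 * dense_const * sqrt N\<close>.\<close>

definition norm_const :: real where
  "norm_const = 2 * exp 1 * dense_const"

lemma norm_const_ge_1: "norm_const \<ge> 1"
proof -
  have 1: "(1 :: real) \<le> exp 1" "(1 :: real) \<le> exp 8" by simp_all
  have "1 * 1 \<le> 8 * (3 * 2 ^ 16)\<^sup>2 * exp (8 :: real)" using 1 by (intro mult_mono) auto
  hence 2: "1 \<le> dense_const" by (simp add: dense_const_def)
  have "1 \<le> 2 * exp (1 :: real)" using 1(1) by linarith
  hence "1 * 1 \<le> (2 * exp 1) * dense_const" using 2 by (intro mult_mono) auto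
  thus ?thesis by (simp add: norm_const_def)
qed

text \<open>Different links share coins, but a union bound over at most n^(k-1) links does not need
  independence between them; each fails with probability at most n exp(-N).\<close>

lemma links_norm_tail:
  assumes k: "1 \<le> k" "k \<le> n" and p: "0 \<le> p" "p \<le> 1" and np: "2 * (real n * (p * (1 - p))) > 1"
  shows "measure_pmf.prob (coins (subsets_of_size n (k + 1)) p)
      {\<beta>. \<exists>\<tau>\<in>subsets_of_size n (k - 1). \<exists>f. \<bar>bilin (link_vertices n \<tau>) (centred_adj p (link_label \<tau>) \<beta>) f f\<bar>
          > norm_const * sqrt (real n * (p * (1 - p))) * (\<Sum>x\<in>link_vertices n \<tau>. (f x)\<^sup>2)}
    \<le> real n ^ k * exp (- (2 * (real n * (p * (1 - p)))))"
proof -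
  let ?M = "coins (subsets_of_size n (k + 1)) p" and ?T = "subsets_of_size n (k - 1)"
  let ?s = "real n * (p * (1 - p))"
  let ?bad = "\<lambda>\<tau>. {\<beta>. \<exists>f. \<bar>bilin (link_vertices n \<tau>) (centred_adj p (link_label \<tau>) \<beta>) f f\<bar>
          > norm_const * sqrt ?s * (\<Sum>x\<in>link_vertices n \<tau>. (f x)\<^sup>2)}"
  obtain j where j: "j \<ge> 1" "2 * ?s \<le> 2 ^ j" "2 ^ j \<le> 2 * (2 * ?s)"
    using ex_power_of_two_between[OF np] by blast
  define N :: nat where "N = 2 ^ j"
  have N: "2 * ?s \<le> real N" "real N \<le> 4 * ?s" using j by (auto simp: N_def)
  have bad: "measure_pmf.prob ?M (?bad \<tau>) \<le> real n * exp (- (2 * ?s))" if \<tau>: "\<tau> \<in> ?T" for \<tau>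
  proof -
    let ?V = "link_vertices n \<tau>"
    have cardV: "card ?V \<le> n"
      using card_mono[of "{1..n}" ?V] by (auto simp: link_vertices_def)
    have V: "2 * (real (card ?V) * (p * (1 - p))) \<le> real N"
    proof -
      have "real (card ?V) * (p * (1 - p)) \<le> ?s" using cardV p by (intro mult_right_mono) auto
      thus ?thesis using N(1) by linarith
    qed
    have "exp 1 * dense_const * sqrt N \<le> exp 1 * dense_const * sqrt (4 * ?s)"
      using N(2) by (intro mult_left_mono) (auto simp: dense_const_def)
    hence le: "exp 1 * dense_const * sqrt N \<le> norm_const * sqrt ?s"
      by (simp add: real_sqrt_mult norm_const_def)
    have "?bad \<tau> \<subseteq> {\<beta>. \<exists>f. \<bar>bilin ?V (centred_adj p (link_label \<tau>) \<beta>) f f\<bar>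
          > exp 1 * dense_const * sqrt N * (\<Sum>x\<in>?V. (f x)\<^sup>2)}"
    proof clarify
      fix \<beta> f assume "\<bar>bilin ?V (centred_adj p (link_label \<tau>) \<beta>) f f\<bar> > norm_const * sqrt ?s * (\<Sum>x\<in>?V. (f x)\<^sup>2)"
      moreover have "exp 1 * dense_const * sqrt N * (\<Sum>x\<in>?V. (f x)\<^sup>2) \<le> norm_const * sqrt ?s * (\<Sum>x\<in>?V. (f x)\<^sup>2)"
        using le by (intro mult_right_mono) (auto simp: sum_nonneg)
      ultimately show "\<exists>f. \<bar>bilin ?V (centred_adj p (link_label \<tau>) \<beta>) f f\<bar>
          > exp 1 * dense_const * sqrt N * (\<Sum>x\<in>?V. (f x)\<^sup>2)" by (intro exI[of _ f]) linarith
    qed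
    hence "measure_pmf.prob ?M (?bad \<tau>) \<le> measure_pmf.prob ?M {\<beta>. \<exists>f. \<bar>bilin ?V (centred_adj p (link_label \<tau>) \<beta>) f f\<bar>
          > exp 1 * dense_const * sqrt N * (\<Sum>x\<in>?V. (f x)\<^sup>2)}"
      by (intro measure_pmf.finite_measure_mono) auto
    also have "\<dots> \<le> real (card ?V) * exp (- real N)"
      by (rule centred_adj_norm_tail[OF _ _ edge_labelling_link[OF \<tau> k(1)] p N_def j(1) V]) auto
    also have "\<dots> \<le> real n * exp (- (2 * ?s))"
      using cardV N(1) by (intro mult_mono) auto
    finally show ?thesis .
  qed
  have eq: "{\<beta>. \<exists>\<tau>\<in>?T. \<exists>f. \<bar>bilin (link_vertices n \<tau>) (centred_adj p (link_label \<tau>) \<beta>) f f\<bar>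
          > norm_const * sqrt ?s * (\<Sum>x\<in>link_vertices n \<tau>. (f x)\<^sup>2)} = (\<Union>\<tau>\<in>?T. ?bad \<tau>)" by blast
  have "measure_pmf.prob ?M (\<Union>\<tau>\<in>?T. ?bad \<tau>) \<le> (\<Sum>\<tau>\<in>?T. measure_pmf.prob ?M (?bad \<tau>))"
    by (intro measure_UNION_le) auto
  also have "\<dots> \<le> (\<Sum>\<tau>\<in>?T. real n * exp (- (2 * ?s)))"
    by (rule sum_mono) (rule bad)
  also have "\<dots> = real (n choose (k - 1)) * (real n * exp (- (2 * ?s)))"
    by (simp add: card_subsets_of_size)
  also have "\<dots> \<le> real (n ^ (k - 1)) * (real n * exp (- (2 * ?s)))"
    using binomial_le_pow[of "k - 1" n] k by (intro mult_right_mono) (auto simp del: of_nat_power)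
  also have "\<dots> = real n ^ k * exp (- (2 * ?s))"
    using k(1) by (cases k) auto
  finally show ?thesis unfolding eq .
qed

text \<open>
  With \<open>M = C \<surd>(npq)\<close> both bounds of \<open>theta_bounds\<close> are of order \<open>\<surd>((n - k) q / p)\<close>.
\<close>
lemma bounds_order:
  fixes n k p q C :: real
  assumes C: "C \<ge> 1" and k: "k > 0" and n: "n \<ge> 2 * k" and p: "0 < p" "p \<le> 1" and q: "0 < q" "q \<le> 1"
    and np: "n * p \<ge> 1" and nq: "n * q \<ge> 16 * C\<^sup>2"
  defines "M \<equiv> C * sqrt (n * (p * q))"
  shows "M > 0"
    and "1 / (8 * C) * sqrt ((n - k) * q / p) \<le> (q * (n - k) - M) / (q + M)"
    and "k + k * M / p \<le> k * (1 + 2 * C) * sqrt ((n - k) * q / p)"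
proof -
  define L where "L = sqrt (n * (p * q))"
  define a where "a = sqrt ((n - k) * q / p)"
  have nk: "n - k \<ge> n / 2" "n - k > 0" "n > 0" using n k by auto
  have L: "L > 0" "L\<^sup>2 = n * (p * q)" using nk p q by (auto simp: L_def)
  have a: "a > 0" "a\<^sup>2 = (n - k) * q / p" using nk p q by (auto simp: a_def)
  have M: "M = C * L" by (simp add: M_def L_def)
  show Mpos: "M > 0" using C L by (simp add: M)
  have C2: "C\<^sup>2 \<ge> 1" using C by simp
  \<comment> \<open>The assumption on n q makes \<open>M\<close> at most half of the main term, so
    the numerator of the lower bound loses only a factor 2.\<close>
  have 1: "M \<le> q * (n - k) / 2"
  proof (rule power2_le_imp_le)
    have "16 * C\<^sup>2 * p \<le> (n * q) * 1" using nk q p by (intro mult_mono[OF nq p(2)]) auto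
    hence "(n * q) * (16 * C\<^sup>2 * p) \<le> (n * q) * (n * q)" using nk q by (intro mult_left_mono) auto
    moreover have "16 * M\<^sup>2 = (n * q) * (16 * C\<^sup>2 * p)"
      by (simp add: M power_mult_distrib L(2) mult_ac)
    ultimately have "16 * M\<^sup>2 \<le> (n * q)\<^sup>2" by (simp add: power2_eq_square)
    moreover have "(n / 2 * q)\<^sup>2 \<le> ((n - k) * q)\<^sup>2" using nk q by (intro power_mono mult_right_mono) auto
    ultimately show "M\<^sup>2 \<le> (q * (n - k) / 2)\<^sup>2" by (simp add: power_mult_distrib power_divide mult.commute)
  qed (use q nk in simp)
  \<comment> \<open>Thus \<open>M\<close> dominates the denominator \<open>q + M\<close> up to a
    factor 2.\<close>
  have 2: "q \<le> M"
  proof -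
    have "q \<le> L"
    proof (rule power2_le_imp_le)
      have "q * q \<le> q * 1" using q by (intro mult_left_mono) auto
      also have "\<dots> \<le> q * (n * p)" using q np by (intro mult_left_mono) auto
      finally show "q\<^sup>2 \<le> L\<^sup>2" unfolding L(2) by (simp add: power2_eq_square mult_ac)
    qed (use L in simp)
    also have "L \<le> C * L" using C L by simp
    finally show ?thesis by (simp add: M)
  qed
  have 3: "a * L \<le> 2 * (q * (n - k))"
  proof (rule power2_le_imp_le)
    have "(a * L)\<^sup>2 = (n - k) * n * q\<^sup>2"
      unfolding power_mult_distrib a(2) L(2) using p by (simp add: power2_eq_square)
    also have "\<dots> \<le> (n - k) * (4 * (n - k)) * q\<^sup>2"
      using nk by (intro mult_right_mono mult_left_mono) auto
    also have "\<dots> = (2 * (q * (n - k)))\<^sup>2" by (simp add: power2_eq_square)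
    finally show "(a * L)\<^sup>2 \<le> (2 * (q * (n - k)))\<^sup>2" .
  qed (use q nk in simp)
  have "1 / (8 * C) * a = (a * L) / (8 * M)" using C L by (simp add: M)
  also have "\<dots> \<le> 2 * (q * (n - k)) / (8 * M)" using 3 Mpos by (intro divide_right_mono) auto
  also have "\<dots> = (q * (n - k) / 2) / (2 * M)" by simp
  also have "\<dots> \<le> (q * (n - k) - M) / (2 * M)" using 1 Mpos by (intro divide_right_mono) auto
  also have "\<dots> \<le> (q * (n - k) - M) / (q + M)"
    using 1 2 Mpos q by (intro divide_left_mono) (auto intro!: mult_pos_pos)
  finally show "1 / (8 * C) * sqrt ((n - k) * q / p) \<le> (q * (n - k) - M) / (q + M)" unfolding a_def .
  \<comment> \<open>This absorbs the additive \<open>k\<close> of the upper bound into the main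
    term.\<close>
  have 4: "1 \<le> a"
  proof -
    have "p \<le> n * q / 2" using nq C2 p by linarith
    also have "\<dots> \<le> (n - k) * q" using mult_right_mono[OF nk(1), of q] q by simp
    finally have "1 \<le> (n - k) * q / p" using p by simp
    thus ?thesis by (simp add: a_def)
  qed
  have 5: "L / p \<le> 2 * a"
  proof (rule power2_le_imp_le)
    have "(L / p)\<^sup>2 = n * q / p" unfolding power_divide L(2) using p by (simp add: power2_eq_square)
    also have "\<dots> \<le> (4 * (n - k)) * q / p"
      using nk p q by (intro divide_right_mono mult_right_mono) auto
    also have "\<dots> = (2 * a)\<^sup>2" unfolding power_mult_distrib a(2) by (simp only: times_divide_eq_right mult.assoc) simp
    finally show "(L / p)\<^sup>2 \<le> (2 * a)\<^sup>2" .
  qed (use a in simp)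
  have "k + k * M / p = k * (1 + C * (L / p))" by (simp add: M distrib_left)
  also have "\<dots> \<le> k * (a + C * (2 * a))"
    using 4 5 C k by (intro mult_left_mono add_mono) auto
  also have "\<dots> = k * (1 + 2 * C) * a" by (simp add: algebra_simps)
  finally show "k + k * M / p \<le> k * (1 + 2 * C) * sqrt ((n - k) * q / p)" unfolding a_def .
qed

lemma linial_meshulam_eq: "linial_meshulam k n p = map_pmf (complex_of_coins k n) (coins (subsets_of_size n (k + 1)) p)"
  unfolding linial_meshulam_def complex_of_coins_def[abs_def] by (rule refl)

theorem theorem9p3:
  fixes k :: nat and c :: real
  assumes "k \<ge> 1" and "c > 0"
  shows "\<exists>c0>0. \<exists>c1>0. \<exists>c2>0. \<forall>n\<ge>1. \<forall>p q :: real.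
           c0 * ln (real n) / real n \<le> p \<longrightarrow>
           p \<le> 1 - c0 * ln (real n) / real n \<longrightarrow>
           q = 1 - p \<longrightarrow>
           measure_pmf.prob (linial_meshulam k n p)
             {X. c1 * sqrt ((real n - real k) * q / p) \<le> theta k n X \<and>
                 theta k n X \<le> c2 * sqrt ((real n - real k) * q / p)}
           \<ge> 1 - real n powr (- c)"
proof -
  define C where "C = norm_const"
  have C: "C \<ge> 1" using norm_const_ge_1 by (simp add: C_def)
  \<comment> \<open>The part c + k beats the n^k of the union bound, 2k forces n >= 2k, and 32 C^2
    gives n q >= 16 C^2 once ln n >= 1/2 is used.\<close>
  define c0 where "c0 = c + 2 * real k + 32 * C\<^sup>2"
  have C2: "C\<^sup>2 \<ge> 1" using C by simp
  have c0: "c0 \<ge> c + real k" "c0 \<ge> 2 * real k" "c0 \<ge> 32 * C\<^sup>2" "c0 \<ge> 32"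
    using assms C2 by (auto simp: c0_def)
  have main: "measure_pmf.prob (linial_meshulam k n p)
             {X. 1 / (8 * C) * sqrt ((real n - real k) * q / p) \<le> theta k n X \<and>
                 theta k n X \<le> (real k * (1 + 2 * C)) * sqrt ((real n - real k) * q / p)}
           \<ge> 1 - real n powr (- c)"
    if n: "n \<ge> 1" and p1: "c0 * ln (real n) / real n \<le> p" and p2: "p \<le> 1 - c0 * ln (real n) / real n"
      and q: "q = 1 - p" for n p q
  proof (cases "n = 1")
    \<comment> \<open>For n = 1 the claimed lower bound on the probability is 1 - 1 = 0.\<close>
    case True
    thus ?thesis by simp
  next
    case False
    with n have n2: "n \<ge> 2" by simp
    have ln2: "ln (real n) \<ge> 1 / 2"
    proof -
      have "1 / 2 \<le> ln (2 :: real)" using ln2_ge_two_thirds by simp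
      also have "\<dots> \<le> ln (real n)" using n2 by simp
      finally show ?thesis .
    qed
    have pn: "real n * p \<ge> c0 * ln (real n)" and qn: "real n * q \<ge> c0 * ln (real n)"
      using p1 p2 n2 by (auto simp: q field_simps)
    have cl: "c0 * ln (real n) \<ge> c0 / 2" using mult_left_mono[OF ln2, of c0] c0 by simp
    have pos: "p > 0" "q > 0"
    proof -
      have "real n * p > 0" "real n * q > 0" using pn qn cl c0 by linarith+
      thus "p > 0" "q > 0" using n2 by (simp_all add: zero_less_mult_iff)
    qed
    have le1: "p \<le> 1" "q \<le> 1" using pos q by auto
    \<comment> \<open>The two assumptions on p add up to n >= 2 c0 ln n >= c0. So for small n no
      admissible p exists, and k <= n needs no separate assumption.\<close>
    have "2 * (c0 * ln (real n)) \<le> real n * p + real n * q" using pn qn by linarith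
    also have "\<dots> = real n" by (simp add: q algebra_simps)
    finally have nc0: "real n \<ge> c0" using cl by linarith
    hence nk: "real n \<ge> 2 * real k" using c0 by linarith
    hence kn: "k \<le> n" by simp
    let ?s = "real n * (p * (1 - p))"
    \<comment> \<open>The larger of p and q is at least 1/2, so 2npq is at least the smaller of np
      and nq.\<close>
    have s: "2 * ?s \<ge> c0 * ln (real n)"
    proof (cases "p \<ge> 1 / 2")
      case True
      have "c0 * ln (real n) \<le> real n * q" by (rule qn)
      also have "\<dots> \<le> (2 * p) * (real n * q)" using mult_right_mono[of 1 "2 * p" "real n * q"] True pos by simp
      finally show ?thesis by (simp add: q mult_ac)
    next
      case F: False
      have "c0 * ln (real n) \<le> real n * p" by (rule pn)
      also have "\<dots> \<le> (2 * q) * (real n * p)" using mult_right_mono[of 1 "2 * q" "real n * p"] F q pos by simp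
      finally show ?thesis by (simp add: q mult_ac)
    qed
    have s1: "2 * ?s > 1" using s cl c0 by linarith
    let ?M = "coins (subsets_of_size n (k + 1)) p"
    define bad where "bad = {\<beta>. \<exists>\<tau>\<in>subsets_of_size n (k - 1). \<exists>f. \<bar>bilin (link_vertices n \<tau>) (centred_adj p (link_label \<tau>) \<beta>) f f\<bar>
          > C * sqrt ?s * (\<Sum>x\<in>link_vertices n \<tau>. (f x)\<^sup>2)}"
    have "measure_pmf.prob ?M bad \<le> real n ^ k * exp (- (2 * ?s))"
      unfolding bad_def C_def by (rule links_norm_tail[OF assms(1) kn _ le1(1) s1]) (use pos in simp)
    also have "\<dots> \<le> real n powr real k * exp (- (c0 * ln (real n)))"
      using s n2 by (simp add: powr_realpow)
    also have "\<dots> = real n powr (real k - c0)"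
      using n2 by (simp add: powr_def flip: exp_add) (simp add: algebra_simps)
    also have "\<dots> \<le> real n powr (- c)"
      using c0 n2 by (intro powr_mono) auto
    finally have bad: "measure_pmf.prob ?M bad \<le> real n powr (- c)" .
    let ?A = "{X. 1 / (8 * C) * sqrt ((real n - real k) * q / p) \<le> theta k n X \<and>
                 theta k n X \<le> (real k * (1 + 2 * C)) * sqrt ((real n - real k) * q / p)}"
    have "- bad \<subseteq> complex_of_coins k n -` ?A"
    proof
      fix \<beta> assume "\<beta> \<in> - bad"
      hence norm: "\<And>\<tau> f. \<tau> \<in> subsets_of_size n (k - 1) \<Longrightarrow>
        \<bar>bilin (link_vertices n \<tau>) (centred_adj p (link_label \<tau>) \<beta>) f f\<bar>
          \<le> C * sqrt ?s * (\<Sum>x\<in>link_vertices n \<tau>. (f x)\<^sup>2)"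
        unfolding bad_def by (auto simp: not_less)
      have np: "real n * p \<ge> 1" "real n * q \<ge> 16 * C\<^sup>2" using pn qn cl c0 by linarith+
      have kpos: "real k > 0" using assms(1) by simp
      note order = bounds_order[OF C kpos nk pos(1) le1(1) pos(2) le1(2) np, unfolded q]
      note th = theta_bounds[OF assms(1) norm pos(1) le1(1) order(1) kn]
      have "1 / (8 * C) * sqrt ((real n - real k) * q / p) \<le> theta k n (complex_of_coins k n \<beta>)"
        using order(2) th(1) unfolding q by (rule order_trans)
      moreover have "theta k n (complex_of_coins k n \<beta>) \<le> (real k * (1 + 2 * C)) * sqrt ((real n - real k) * q / p)"
        using th(2) order(3) unfolding q by (rule order_trans)
      ultimately show "\<beta> \<in> complex_of_coins k n -` ?A" by simp
    qed
    hence "measure_pmf.prob ?M (- bad) \<le> measure_pmf.prob ?M (complex_of_coins k n -` ?A)"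
      by (intro measure_pmf.finite_measure_mono) auto
    moreover have "measure_pmf.prob ?M (- bad) = 1 - measure_pmf.prob ?M bad"
      using measure_pmf.prob_compl[of bad ?M] by (simp add: Compl_eq_Diff_UNIV)
    ultimately show ?thesis using bad unfolding linial_meshulam_eq measure_map_pmf by linarith
  qed
  show ?thesis
  proof (intro exI conjI allI impI)
    show "c0 > 0" using c0 by linarith
    show "1 / (8 * C) > 0" "real k * (1 + 2 * C) > 0" using C assms(1) by simp_all
  qed (rule main)
qed

end
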